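(* Let $V$ be a subset of a discrete group $\Gamma$. Suppose that, for every $1\le r\le6$, every pairwise distinct $g_1,\ldots,g_r\in V$, and every $C_1,\ldots,C_r\in M_2(\mathbb C)$, $$\|(C_m)_{m=1}^r\|_{S_1^2(\ell_2)}\le\sqrt2\,(\operatorname{tr}\otimes\tau)\left|\sum_{m=1}^rC_m\otimes\lambda_{g_m}\right|.$$ Then $Z_2(V)\le2$.
   Context: $\lambda_g$ ($g\in\Gamma$) are the canonical unitaries of the left regular representation on $\ell_2(\Gamma)$, $\mathcal L(\Gamma)$ is the group von Neumann algebra they generate, and $\tau$ is its canonical tracial state, $\tau(\lambda_g)=\delta_{g,e}$. $\operatorname{tr}$ is the usual unnormalized trace on $M_d(\mathbb C)$. For a finite family $(C_k)$ in $M_d(\mathbb C)$ (here $d=2$), $$\|(C_k)\|_{S_1^d(\ell_2)}=\inf\left\{\operatorname{tr}\Big(\sum_kX_k^*X_k\Big)^{1/2}+\operatorname{tr}\Big(\sum_kY_kY_k^*\Big)^{1/2}: C_k=X_k+Y_k,\ X_k,Y_k\in M_d(\mathbb C)\right\}.$$ $Z_2^c(V)=\sup_{g\ne e}\#\{(x,y)\in V^2:x^{-1}y=g\}$ (ordered pairs), $Z_2^r(V)=Z_2^c(V^{-1})$ where $V^{-1}=\{x^{-1}:x\in V\}$, and $Z_2(V)=\max\{Z_2^c(V),Z_2^r(V)\}$. *)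

theory Defs
  imports "HOL-Analysis.Analysis" "HOL-Algebra.Group"
begin

section \<open>Bounded operators on $\ell_2(I)$\<close>

text \<open>
  \<open>ell2 I\<close> is the complex Hilbert space of square-summable families indexed by the
  (arbitrary, possibly uncountable) set \<open>I\<close>, represented by functions vanishing off \<open>I\<close>.
  The inner product is conjugate-linear in its first argument.
\<close>

definition ell2 :: "'i set \<Rightarrow> ('i \<Rightarrow> complex) set" where
  "ell2 I = {f. (\<forall>i. i \<notin> I \<longrightarrow> f i = 0) \<and> (\<lambda>i. (cmod (f i))\<^sup>2) summable_on I}"

definition ell2_inner :: "'i set \<Rightarrow> ('i \<Rightarrow> complex) \<Rightarrow> ('i \<Rightarrow> complex) \<Rightarrow> complex" where
  "ell2_inner I f g = (\<Sum>\<^sub>\<infinity>i\<in>I. cnj (f i) * g i)"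

definition ell2_norm :: "'i set \<Rightarrow> ('i \<Rightarrow> complex) \<Rightarrow> real" where
  "ell2_norm I f = sqrt (\<Sum>\<^sub>\<infinity>i\<in>I. (cmod (f i))\<^sup>2)"

text \<open>
  Operators are required to be \<open>extensional\<close> (\<open>undefined\<close> off \<open>ell2 I\<close>), so that two
  operators agreeing on \<open>ell2 I\<close> are equal; the definite descriptions below depend on this.
\<close>

definition bounded_ops :: "'i set \<Rightarrow> (('i \<Rightarrow> complex) \<Rightarrow> ('i \<Rightarrow> complex)) set" where
  "bounded_ops I = {T \<in> ell2 I \<rightarrow>\<^sub>E ell2 I.
     (\<forall>f\<in>ell2 I. \<forall>g\<in>ell2 I. T (\<lambda>i. f i + g i) = (\<lambda>i. T f i + T g i)) \<and>
     (\<forall>a. \<forall>f\<in>ell2 I. T (\<lambda>i. a * f i) = (\<lambda>i. a * T f i)) \<and>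
     (\<exists>K. \<forall>f\<in>ell2 I. ell2_norm I (T f) \<le> K * ell2_norm I f)}"

definition op_adj ::
  "'i set \<Rightarrow> (('i \<Rightarrow> complex) \<Rightarrow> ('i \<Rightarrow> complex)) \<Rightarrow> (('i \<Rightarrow> complex) \<Rightarrow> ('i \<Rightarrow> complex))" where
  "op_adj I T = (THE S. S \<in> bounded_ops I \<and>
     (\<forall>f\<in>ell2 I. \<forall>g\<in>ell2 I. ell2_inner I (T f) g = ell2_inner I f (S g)))"

definition positive_op :: "'i set \<Rightarrow> (('i \<Rightarrow> complex) \<Rightarrow> ('i \<Rightarrow> complex)) \<Rightarrow> bool" where
  "positive_op I S \<longleftrightarrow> S \<in> bounded_ops I \<and> (\<forall>f\<in>ell2 I. ell2_inner I f (S f) \<in> \<real>\<^sub>\<ge>\<^sub>0)"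

text \<open>The absolute value $|T| = (T^*T)^{1/2}$: the unique positive square root of $T^*T$.\<close>

definition op_abs ::
  "'i set \<Rightarrow> (('i \<Rightarrow> complex) \<Rightarrow> ('i \<Rightarrow> complex)) \<Rightarrow> (('i \<Rightarrow> complex) \<Rightarrow> ('i \<Rightarrow> complex))" where
  "op_abs I T = (THE S. positive_op I S \<and> (\<forall>f\<in>ell2 I. S (S f) = op_adj I T (T f)))"

definition op_sum ::
  "'i set \<Rightarrow> 'k set \<Rightarrow> ('k \<Rightarrow> ('i \<Rightarrow> complex) \<Rightarrow> ('i \<Rightarrow> complex)) \<Rightarrow>
   (('i \<Rightarrow> complex) \<Rightarrow> ('i \<Rightarrow> complex))" where
  "op_sum I K T = (\<lambda>f\<in>ell2 I. \<lambda>i. \<Sum>k\<in>K. T k f i)"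

section \<open>The left regular representation and $\mathrm{tr}\otimes\tau$\<close>

definition left_reg ::
  "('a, 'b) monoid_scheme \<Rightarrow> 'a \<Rightarrow> ('a \<Rightarrow> complex) \<Rightarrow> ('a \<Rightarrow> complex)" where
  "left_reg G g = (\<lambda>f\<in>ell2 (carrier G). \<lambda>h.
     if h \<in> carrier G then f (inv\<^bsub>G\<^esub> g \<otimes>\<^bsub>G\<^esub> h) else 0)"

text \<open>
  The canonical trace of the group von Neumann algebra is the restriction to it of the
  vector functional of $\delta_e$, which is what \<open>vn_trace\<close> is, on all operators.
\<close>

definition vn_trace ::
  "('a, 'b) monoid_scheme \<Rightarrow> (('a \<Rightarrow> complex) \<Rightarrow> ('a \<Rightarrow> complex)) \<Rightarrow> complex" where
  "vn_trace G T = ell2_inner (carrier G)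
     (\<lambda>h. of_bool (h = \<one>\<^bsub>G\<^esub>)) (T (\<lambda>h. of_bool (h = \<one>\<^bsub>G\<^esub>)))"

text \<open>
  $\mathbb{C}^n\otimes\ell_2(I)$ is realised as \<open>ell2 (UNIV \<times> I)\<close>, with \<open>UNIV :: 'n set\<close>.
  \<open>mat_tensor I C T\<close> is $C\otimes T$, and \<open>op_block I S i j\<close> is the \<open>(i, j)\<close> entry of \<open>S\<close>,
  regarded as a matrix of operators on $\ell_2(I)$.
\<close>

definition mat_tensor ::
  "'i set \<Rightarrow> complex^'n^'n \<Rightarrow> (('i \<Rightarrow> complex) \<Rightarrow> ('i \<Rightarrow> complex)) \<Rightarrow>
   (('n::finite \<times> 'i \<Rightarrow> complex) \<Rightarrow> ('n \<times> 'i \<Rightarrow> complex))" where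
  "mat_tensor I C T = (\<lambda>f\<in>ell2 (UNIV \<times> I). \<lambda>(i, h). \<Sum>j\<in>UNIV. C $ i $ j * T (\<lambda>k. f (j, k)) h)"

definition op_block ::
  "'i set \<Rightarrow> (('n::finite \<times> 'i \<Rightarrow> complex) \<Rightarrow> ('n \<times> 'i \<Rightarrow> complex)) \<Rightarrow> 'n \<Rightarrow> 'n \<Rightarrow>
   (('i \<Rightarrow> complex) \<Rightarrow> ('i \<Rightarrow> complex))" where
  "op_block I S i j = (\<lambda>f\<in>ell2 I. \<lambda>h. S (\<lambda>(l, k). if l = j then f k else 0) (i, h))"

definition tr_vn_trace ::
  "('a, 'b) monoid_scheme \<Rightarrow> (('n::finite \<times> 'a \<Rightarrow> complex) \<Rightarrow> ('n \<times> 'a \<Rightarrow> complex)) \<Rightarrow> complex"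
  where
  "tr_vn_trace G S = (\<Sum>i\<in>UNIV. vn_trace G (op_block (carrier G) S i i))"

lemma delta_in_ell2:
  assumes "a \<in> I"
  shows "(\<lambda>h. of_bool (h = a)) \<in> ell2 I"
proof -
  have "(\<lambda>h. (cmod (of_bool (h = a)))\<^sup>2) summable_on {a}"
    by simp
  then have "(\<lambda>h. (cmod (of_bool (h = a)))\<^sup>2) summable_on I"
    by (rule summable_on_cong_neutral[THEN iffD1, rotated -1]) (use assms in auto)
  then show ?thesis
    using assms by (auto simp: ell2_def)
qed

lemma delta_inner:
  assumes "a \<in> I"
  shows "ell2_inner I (\<lambda>h. of_bool (h = a)) f = f a"
proof -
  have "ell2_inner I (\<lambda>h. of_bool (h = a)) f = (\<Sum>\<^sub>\<infinity>h\<in>{a}. f h)"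
    unfolding ell2_inner_def by (rule infsum_cong_neutral) (use assms in auto)
  then show ?thesis
    by simp
qed

lemma vn_trace_left_reg:
  assumes "group G" "g \<in> carrier G"
  shows "vn_trace G (left_reg G g) = of_bool (g = \<one>\<^bsub>G\<^esub>)"
proof -
  interpret group G by fact
  show ?thesis
    using assms(2) by (simp add: vn_trace_def delta_inner left_reg_def delta_in_ell2)
qed

lemma tr_vn_trace_mat_tensor:
  fixes C :: "complex^'n::finite^'n"
  assumes "group G" "T \<in> bounded_ops (carrier G)"
  shows "tr_vn_trace G (mat_tensor (carrier G) C T) = trace C * vn_trace G T"
proof -
  interpret group G by fact
  define d :: "'a \<Rightarrow> complex" where "d = (\<lambda>h. of_bool (h = \<one>\<^bsub>G\<^esub>))"
  have d: "d \<in> ell2 (carrier G)"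
    unfolding d_def by (rule delta_in_ell2) simp
  have T0: "T (\<lambda>_. 0) = (\<lambda>_. 0)"
  proof -
    have "\<forall>a. \<forall>f\<in>ell2 (carrier G). T (\<lambda>i. a * f i) = (\<lambda>i. a * T f i)"
      using assms(2) by (simp add: bounded_ops_def)
    from this[THEN spec, of 0, THEN bspec, OF d] show ?thesis
      by simp
  qed
  have emb: "(\<lambda>(l, k). if l = i then d k else 0) \<in> ell2 (UNIV \<times> carrier G)" for i :: 'n
  proof -
    have "(\<lambda>(l, k). if l = i then d k else 0) = (\<lambda>p. of_bool (p = (i, \<one>\<^bsub>G\<^esub>)))"
      by (auto simp: d_def fun_eq_iff)
    then show ?thesis
      by (simp add: delta_in_ell2)
  qed
  have "op_block (carrier G) (mat_tensor (carrier G) C T) i i d \<one>\<^bsub>G\<^esub> = C $ i $ i * T d \<one>\<^bsub>G\<^esub>" for i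
  proof -
    have "op_block (carrier G) (mat_tensor (carrier G) C T) i i d \<one>\<^bsub>G\<^esub> =
          (\<Sum>j\<in>UNIV. C $ i $ j * T (\<lambda>k. if j = i then d k else 0) \<one>\<^bsub>G\<^esub>)"
      using d emb[of i] by (simp add: op_block_def mat_tensor_def)
    also have "\<dots> = (\<Sum>j\<in>UNIV. if j = i then C $ i $ i * T d \<one>\<^bsub>G\<^esub> else 0)"
      by (rule sum.cong) (auto simp: T0)
    finally show ?thesis
      by simp
  qed
  then show ?thesis
    unfolding tr_vn_trace_def vn_trace_def d_def[symmetric]
    by (simp add: d_def[abs_def] delta_inner trace_def sum_distrib_right)
qed

section \<open>The norm of $S_1^d(\ell_2)$\<close>

definition mat_adj :: "complex^'n^'n \<Rightarrow> complex^'n^'n" where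
  "mat_adj A = (\<chi> i j. cnj (A $ j $ i))"

definition mat_psd :: "complex^'n::finite^'n \<Rightarrow> bool" where
  "mat_psd A \<longleftrightarrow> (\<forall>v. (\<Sum>i\<in>UNIV. cnj (v $ i) * (A *v v) $ i) \<in> \<real>\<^sub>\<ge>\<^sub>0)"

definition mat_sqrt :: "complex^'n::finite^'n \<Rightarrow> complex^'n^'n" where
  "mat_sqrt A = (THE R. mat_psd R \<and> R ** R = A)"

text \<open>
  In the customary notation $\mathrm{tr}(\,\cdot\,)^{1/2}$ the exponent belongs to the matrix,
  i.e. the trace of the square root is taken. These traces are nonnegative reals.
\<close>

definition S1_ell2_norm :: "'k set \<Rightarrow> ('k \<Rightarrow> complex^'n::finite^'n) \<Rightarrow> real" where
  "S1_ell2_norm K C = Inf {Re (trace (mat_sqrt (\<Sum>k\<in>K. mat_adj (X k) ** X k))) +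
                           Re (trace (mat_sqrt (\<Sum>k\<in>K. Y k ** mat_adj (Y k)))) | X Y.
                           \<forall>k\<in>K. C k = X k + Y k}"

section \<open>The constants $Z_2$\<close>

definition ecard :: "'a set \<Rightarrow> enat" where
  "ecard A = (if finite A then enat (card A) else \<infinity>)"

definition Z2c :: "('a, 'b) monoid_scheme \<Rightarrow> 'a set \<Rightarrow> enat" where
  "Z2c G V = (SUP g\<in>carrier G - {\<one>\<^bsub>G\<^esub>}. ecard {(x, y) \<in> V \<times> V. inv\<^bsub>G\<^esub> x \<otimes>\<^bsub>G\<^esub> y = g})"

definition Z2r :: "('a, 'b) monoid_scheme \<Rightarrow> 'a set \<Rightarrow> enat" where
  "Z2r G V = Z2c G ((\<lambda>x. inv\<^bsub>G\<^esub> x) ` V)"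

definition Z2 :: "('a, 'b) monoid_scheme \<Rightarrow> 'a set \<Rightarrow> enat" where
  "Z2 G V = max (Z2c G V) (Z2r G V)"

end

theory Submission
  imports Defs
begin

text \<open>
  Suppose that some \<open>g \<noteq> e\<close> is $x^{-1}y$ for three pairs in \<open>V\<close>, that is, $x_i,x_ig\in V$ for distinct
  $x_1,x_2,x_3$. If $x_2,x_3$ do not differ by right multiplication with \<open>g\<close>, consider
  $f = \binom{\sqrt2\,\lambda_{x_1}}{\lambda_{x_2}+\lambda_{x_3}}(1\;\;\lambda_g)$. Its coefficients satisfy
  $\sum C^*C=\sum CC^*=4$, so by duality their $S_1^2(\ell_2)$ norm is at least 4. On the other hand \<open>f\<close>
  vanishes on the kernel of the projection $p=\frac12(1\;\;\lambda_g)^*(1\;\;\lambda_g)$ of trace 1, so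
  Cauchy--Schwarz gives $\|f\|_1=\mathrm{tr}(|f|p)\le\|f\|_2\|p\|_2=\sqrt8$; equality would force $f^*f=8p$, which
  fails because $\lambda_{x_2}+\lambda_{x_3}$ is not a multiple of a unitary. Otherwise the $x_i$ form a coset of
  a group of order 3, and the scalar element $\sum\lambda_{x_i}$ does the job. The pairs counted by
  $Z_2^r$ reduce to this case by passing to $f^*$, since $\|f\|_1=\|f^*\|_1$.
\<close>

text \<open>\<open>op_adj\<close>, \<open>op_abs\<close> and \<open>mat_sqrt\<close> are definite
  descriptions, so nothing can be said about a trace norm before positive square roots are known to
  exist and to be unique. The power series of 1 - sqrt(1 - x) provides both and spares the spectral
  theorem and the polar decomposition: a map that intertwines two operators intertwines their roots,
  and the trace of a root is a series in traces of powers. The latter is how ||f||_1 = ||f^*||_1 is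
  obtained. The constant sqrt 2 is met exactly: for the 2 by 2 element the lower bound 4 equals sqrt
  2 times sqrt 8, so everything depends on strictness. For this reason Cauchy-Schwarz is kept in the
  form 2 t tr|f| \<le> ||f||_2^2 + t^2 ||p||_2^2, whose defect is a sum of squares. For the coset, 2
  sqrt 3 already exceeds 2 sqrt 2, and the weak bound suffices.\<close>

section \<open>Square roots of positive operators\<close>

text \<open>The Taylor coefficients of $1 - \sqrt{1-x}$, as determined by the equation
  $2D(x) = x + D(x)^2$.\<close>

fun sqrt_coeff :: "nat \<Rightarrow> real" where
  "sqrt_coeff n = (if n = 0 then 0 else
     (of_bool (n = 1) + (\<Sum>i\<in>{1..<n}. sqrt_coeff i * sqrt_coeff (n - i))) / 2)"

declare sqrt_coeff.simps [simp del]

lemma sqrt_coeff_0 [simp]: "sqrt_coeff 0 = 0"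
  by (simp add: sqrt_coeff.simps)

lemma sqrt_coeff_nonneg: "sqrt_coeff n \<ge> 0"
proof (induction n rule: less_induct)
  case (less n)
  have "(\<Sum>i\<in>{1..<n}. sqrt_coeff i * sqrt_coeff (n - i)) \<ge> 0"
    using less by (intro sum_nonneg mult_nonneg_nonneg) auto
  then show ?case
    by (subst sqrt_coeff.simps) auto
qed

text \<open>The recursion read as D^2 = 2 D - x for the generating function: the constant
  coefficient is zero, so the end terms of the convolution vanish.\<close>

lemma sqrt_coeff_convolution:
  "(\<Sum>i\<le>n. sqrt_coeff i * sqrt_coeff (n - i)) = 2 * sqrt_coeff n - of_bool (n = 1)"
proof -
  have "(\<Sum>i\<le>n. sqrt_coeff i * sqrt_coeff (n - i)) =
        (\<Sum>i\<in>{1..<n}. sqrt_coeff i * sqrt_coeff (n - i))"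
    by (rule sum.mono_neutral_right) (auto simp: not_less Suc_le_eq)
  then show ?thesis
    by (cases "n = 0") (simp_all add: sqrt_coeff.simps[of n])
qed

text \<open>The number 1 is a fixed point of s \<mapsto> (1 + s^2) / 2, and twice the sum of the
  coefficients up to index n is at most 1 plus the square of the sum below n.\<close>

lemma sum_sqrt_coeff_le_1: "(\<Sum>i<n. sqrt_coeff i) \<le> 1"
proof (induction n)
  case (Suc n)
  have "2 * (\<Sum>k<Suc n. sqrt_coeff k) = (\<Sum>k\<le>n. of_bool (k = 1) +
          (\<Sum>i\<le>k. sqrt_coeff i * sqrt_coeff (k - i)))"
    unfolding sqrt_coeff_convolution lessThan_Suc_atMost by (simp add: sum_distrib_left)
  also have "\<dots> \<le> 1 + (\<Sum>k\<le>n. \<Sum>i\<le>k. sqrt_coeff i * sqrt_coeff (k - i))"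
    by (auto simp: sum.distrib of_bool_def)
  also have "(\<Sum>k\<le>n. \<Sum>i\<le>k. sqrt_coeff i * sqrt_coeff (k - i)) =
      (\<Sum>(i, j)\<in>{(i, j). i + j \<le> n}. sqrt_coeff i * sqrt_coeff j)"
    by (simp add: sum.triangle_reindex_eq)
  \<comment> \<open>A pair with i + j \<le> n that contains the index n has 0 as its other index,
    where the coefficient vanishes; so the square may stop before n.\<close>
  also have "\<dots> = (\<Sum>(i, j)\<in>{(i, j). i + j \<le> n} \<inter> {..<n} \<times> {..<n}. sqrt_coeff i * sqrt_coeff j)"
    by (rule sum.mono_neutral_right)
       (auto intro: finite_subset[of _ "{..n} \<times> {..n}"] simp: not_less dest: order_antisym,
        (metis sqrt_coeff_0 add.right_neutral add_leD1 le_neq_implies_less add_le_same_cancel1 le_zero_eq add_leD2 add_le_same_cancel2)+)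
  also have "\<dots> \<le> (\<Sum>(i, j)\<in>{..<n} \<times> {..<n}. sqrt_coeff i * sqrt_coeff j)"
    by (rule sum_mono2) (auto intro!: mult_nonneg_nonneg sqrt_coeff_nonneg)
  also have "\<dots> = (\<Sum>i<n. sqrt_coeff i) * (\<Sum>i<n. sqrt_coeff i)"
    by (simp add: sum_product sum.cartesian_product)
  also have "\<dots> \<le> 1 * 1"
    using Suc by (intro mult_mono) (auto intro!: sum_nonneg sqrt_coeff_nonneg)
  finally show ?case
    by simp
qed simp

lemma summable_sqrt_coeff: "summable sqrt_coeff"
  using sum_sqrt_coeff_le_1 sqrt_coeff_nonneg
  by (intro summableI_nonneg_bounded[where x = 1]) auto

lemma suminf_sqrt_coeff_le_1: "(\<Sum>n. sqrt_coeff n) \<le> 1"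
  using sum_sqrt_coeff_le_1 summable_sqrt_coeff
  by (intro suminf_le_const) auto

text \<open>The operator $1 - \sqrt{1-K}$ for a contraction \<open>K\<close>.\<close>

definition sqrt_series :: "('h::{real_inner, banach} \<Rightarrow> 'h) \<Rightarrow> 'h \<Rightarrow> 'h" where
  "sqrt_series K v = (\<Sum>n. sqrt_coeff n *\<^sub>R (K ^^ n) v)"

lemma norm_funpow_le:
  fixes K :: "'h::real_normed_vector \<Rightarrow> 'h"
  assumes "\<And>v. norm (K v) \<le> norm v"
  shows "norm ((K ^^ n) v) \<le> norm v"
  by (induction n) (auto intro: order_trans[OF assms])

lemma bounded_linear_funpow:
  fixes K :: "'h::real_normed_vector \<Rightarrow> 'h"
  assumes "bounded_linear K"
  shows "bounded_linear (K ^^ n)"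
proof (induction n)
  case (Suc n)
  then show ?case
    using bounded_linear_compose[OF assms Suc] by (simp add: o_def)
qed (simp add: bounded_linear_ident id_def)

lemma summable_norm_sqrt_series:
  fixes K :: "'h::{real_inner, banach} \<Rightarrow> 'h"
  assumes "\<And>v. norm (K v) \<le> norm v"
  shows "summable (\<lambda>n. norm (sqrt_coeff n *\<^sub>R (K ^^ n) v))"
proof (rule summable_comparison_test'[of "\<lambda>n. sqrt_coeff n * norm v" 0])
  show "summable (\<lambda>n. sqrt_coeff n * norm v)"
    using summable_sqrt_coeff by (rule summable_mult2)
qed (auto intro!: mult_left_mono norm_funpow_le assms simp: sqrt_coeff_nonneg)

lemma summable_sqrt_series:
  fixes K :: "'h::{real_inner, banach} \<Rightarrow> 'h"
  assumes "\<And>v. norm (K v) \<le> norm v"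
  shows "summable (\<lambda>n. sqrt_coeff n *\<^sub>R (K ^^ n) v)"
  using summable_norm_sqrt_series[OF assms] by (rule summable_norm_cancel)

lemma norm_sqrt_series_le:
  assumes "\<And>v. norm (K v) \<le> norm v"
  shows "norm (sqrt_series K v) \<le> norm v"
proof -
  have "norm (sqrt_series K v) \<le> (\<Sum>n. norm (sqrt_coeff n *\<^sub>R (K ^^ n) v))"
    unfolding sqrt_series_def by (rule summable_norm[OF summable_norm_sqrt_series[OF assms]])
  also have "\<dots> \<le> (\<Sum>n. sqrt_coeff n * norm v)"
    using summable_norm_sqrt_series[OF assms] summable_mult2[OF summable_sqrt_coeff]
    by (intro suminf_le) (auto intro!: mult_left_mono norm_funpow_le assms simp: sqrt_coeff_nonneg)
  also have "\<dots> = (\<Sum>n. sqrt_coeff n) * norm v"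
    by (rule suminf_mult2[symmetric]) (rule summable_sqrt_coeff)
  also have "\<dots> \<le> 1 * norm v"
    by (intro mult_right_mono suminf_sqrt_coeff_le_1) auto
  finally show ?thesis
    by simp
qed

text \<open>\<open>Q\<close> is continuous, so it passes through the series and turns every power of
  \<open>K\<close> into the same power of \<open>L\<close>. Through
  \<open>op_sqrt_intertwine\<close> this yields commutation with complex scalars, with cuts and with
  competing square roots.\<close>

lemma sqrt_series_intertwine:
  assumes "\<And>v. norm (K v) \<le> norm v" "\<And>v. norm (L v) \<le> norm v"
    and Q: "bounded_linear Q" and QK: "\<And>v. Q (K v) = L (Q v)"
  shows "Q (sqrt_series K v) = sqrt_series L (Q v)"
proof -
  have "Q ((K ^^ n) v) = (L ^^ n) (Q v)" for n
    by (induction n) (simp_all add: QK)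
  then show ?thesis
    unfolding sqrt_series_def bounded_linear.suminf[OF Q summable_sqrt_series[OF assms(1)]]
    by (simp add: linear_cmul[OF bounded_linear.linear[OF Q]])
qed

lemma bounded_linear_sqrt_series:
  assumes K: "bounded_linear K" and le: "\<And>v. norm (K v) \<le> norm v"
  shows "bounded_linear (sqrt_series K)"
proof (rule bounded_linear_intro[of _ 1])
  note lin = bounded_linear.linear[OF bounded_linear_funpow[OF K]]
  note sm = summable_sqrt_series[OF le]
  show "sqrt_series K (x + y) = sqrt_series K x + sqrt_series K y" for x y
    unfolding sqrt_series_def suminf_add[OF sm sm]
    by (simp add: linear_add[OF lin] scaleR_add_right)
  show "sqrt_series K (r *\<^sub>R x) = r *\<^sub>R sqrt_series K x" for r x
    unfolding sqrt_series_def suminf_scaleR_right[OF sm]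
    by (simp add: linear_cmul[OF lin] mult.commute)
qed (use norm_sqrt_series_le[OF le] in auto)

text \<open>The Cauchy product of the series with itself has the coefficients of
  \<open>sqrt_coeff_convolution\<close>, so D^2 = 2 D - x survives the substitution of
  \<open>K\<close> for x.\<close>

lemma sqrt_series_quadratic:
  assumes K: "bounded_linear K" and le: "\<And>v. norm (K v) \<le> norm v"
  shows "sqrt_series K (sqrt_series K v) = 2 *\<^sub>R sqrt_series K v - K v"
proof -
  define c where "c = sqrt_coeff"
  define f where "f = (\<lambda>(n, m). (c n * c m) *\<^sub>R (K ^^ (n + m)) v)"
  note lin = bounded_linear.linear[OF bounded_linear_funpow[OF K]]
  \<comment> \<open>Absolute summability over all pairs licenses both the iterated sum and the
    regrouping. A finite set of pairs lies in a square, over which the products of coefficients add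
    up to at most 1.\<close>
  have "(\<lambda>x. norm (f x)) summable_on UNIV \<times> UNIV"
  proof (rule nonneg_bdd_above_summable_on)
    show "bdd_above (sum (\<lambda>x. norm (f x)) ` {F. F \<subseteq> UNIV \<times> UNIV \<and> finite F})"
    proof (rule bdd_aboveI2)
      fix F :: "(nat \<times> nat) set"
      assume "F \<in> {F. F \<subseteq> UNIV \<times> UNIV \<and> finite F}"
      then have fin: "finite F"
        by simp
      obtain N where N: "fst ` F \<union> snd ` F \<subseteq> {..<N}"
        using finite_nat_bounded[of "fst ` F \<union> snd ` F"] fin by auto
      have "(\<Sum>x\<in>F. norm (f x)) \<le> (\<Sum>x\<in>F. c (fst x) * c (snd x) * norm v)"
        by (rule sum_mono)
           (auto simp: f_def c_def sqrt_coeff_nonneg abs_mult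
                 intro!: mult_left_mono norm_funpow_le le)
      also have "\<dots> \<le> (\<Sum>x\<in>{..<N} \<times> {..<N}. c (fst x) * c (snd x) * norm v)"
        using N by (intro sum_mono2) (auto simp: c_def sqrt_coeff_nonneg image_subset_iff mem_Times_iff)
      also have "\<dots> = (\<Sum>i<N. c i) * (\<Sum>i<N. c i) * norm v"
        unfolding sum_product sum.cartesian_product
        by (simp add: case_prod_unfold sum_distrib_right)
      also have "\<dots> \<le> 1 * 1 * norm v"
        using sum_sqrt_coeff_le_1[of N]
        by (intro mult_mono) (auto intro!: sum_nonneg sqrt_coeff_nonneg simp: c_def)
      finally show "(\<Sum>x\<in>F. norm (f x)) \<le> norm v"
        by simp
    qed
  qed simp
  then have f: "f summable_on UNIV \<times> UNIV"
    by (rule abs_summable_summable)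
  have sm: "(\<lambda>n. norm (c n *\<^sub>R (K ^^ n) w)) summable_on UNIV" for w
    using summable_norm_sqrt_series[OF le, of w]
    unfolding c_def by (intro summable_nonneg_imp_summable_on) auto
  have sr: "sqrt_series K w = (\<Sum>\<^sub>\<infinity>n. c n *\<^sub>R (K ^^ n) w)" for w
    unfolding sqrt_series_def c_def
    by (rule infsumI[symmetric], rule norm_summable_imp_has_sum)
       (rule summable_norm_sqrt_series[OF le] summable_sums[OF summable_sqrt_series[OF le]])+
  have "sqrt_series K (sqrt_series K v) = (\<Sum>\<^sub>\<infinity>n. c n *\<^sub>R (K ^^ n) (\<Sum>\<^sub>\<infinity>m. c m *\<^sub>R (K ^^ m) v))"
    by (simp only: sr)
  also have "\<dots> = (\<Sum>\<^sub>\<infinity>n. \<Sum>\<^sub>\<infinity>m. f (n, m))"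
  proof (rule infsum_cong)
    fix n
    have "bounded_linear (\<lambda>w. c n *\<^sub>R (K ^^ n) w)"
      by (intro bounded_linear_compose[OF bounded_linear_scaleR_right] bounded_linear_funpow K)
    from infsumI[OF has_sum_bounded_linear[OF this has_sum_infsum[OF abs_summable_summable[OF sm[of v]]]]]
    show "c n *\<^sub>R (K ^^ n) (\<Sum>\<^sub>\<infinity>m. c m *\<^sub>R (K ^^ m) v) = (\<Sum>\<^sub>\<infinity>m. f (n, m))"
      by (simp add: o_def f_def linear_cmul[OF lin] funpow_add)
  qed
  also have "\<dots> = infsum f (UNIV \<times> UNIV)"
    by (rule infsum_Sigma_banach) (rule f)
  \<comment> \<open>The pair (n, m) is re-indexed as (n + m, n), so that the total degree becomes
    the outer index.\<close>
  also have "\<dots> = (\<Sum>\<^sub>\<infinity>p\<in>Sigma UNIV (\<lambda>k. {..k}). f (snd p, fst p - snd p))"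
  proof (rule infsum_reindex_bij_betw[symmetric])
    show "bij_betw (\<lambda>p. (snd p, fst p - snd p)) (Sigma UNIV (\<lambda>k::nat. {..k})) (UNIV \<times> UNIV)"
      by (rule bij_betw_byWitness[where f' = "\<lambda>(n, m). (n + m, n)"]) auto
  qed
  also have "\<dots> = (\<Sum>\<^sub>\<infinity>k. \<Sum>\<^sub>\<infinity>i\<in>{..k}. f (i, k - i))"
  proof -
    have "(\<lambda>p. f (snd p, fst p - snd p)) summable_on Sigma UNIV (\<lambda>k. {..k})"
      by (subst summable_on_reindex_bij_betw[where g = "\<lambda>p. (snd p, fst p - snd p)" and B = "UNIV \<times> UNIV"])
         (use f in \<open>auto intro!: bij_betw_byWitness[where f' = "\<lambda>(n, m). (n + m, n)"]\<close>)
    from infsum_Sigma_banach[OF this] show ?thesis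
      by simp
  qed
  also have "\<dots> = (\<Sum>\<^sub>\<infinity>k. (2 * c k - of_bool (k = 1)) *\<^sub>R (K ^^ k) v)"
  proof (rule infsum_cong)
    fix k
    have "(\<Sum>i\<le>k. f (i, k - i)) = (\<Sum>i\<le>k. c i * c (k - i)) *\<^sub>R (K ^^ k) v"
      by (simp add: f_def scaleR_sum_left)
    then show "(\<Sum>\<^sub>\<infinity>i\<in>{..k}. f (i, k - i)) = (2 * c k - of_bool (k = 1)) *\<^sub>R (K ^^ k) v"
      by (simp add: c_def sqrt_coeff_convolution)
  qed
  also have "\<dots> = (\<Sum>\<^sub>\<infinity>k. 2 *\<^sub>R (c k *\<^sub>R (K ^^ k) v) + of_bool (k = 1) *\<^sub>R (- K v))"
    by (rule infsum_cong) (auto simp: algebra_simps)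
  also have "\<dots> = (\<Sum>\<^sub>\<infinity>k. 2 *\<^sub>R (c k *\<^sub>R (K ^^ k) v)) + (\<Sum>\<^sub>\<infinity>k::nat. of_bool (k = 1) *\<^sub>R (- K v))"
  proof (rule infsum_add)
    show "(\<lambda>k. 2 *\<^sub>R (c k *\<^sub>R (K ^^ k) v)) summable_on UNIV"
      by (intro summable_on_scaleR_right abs_summable_summable[OF sm])
    show "(\<lambda>k::nat. of_bool (k = 1) *\<^sub>R (- K v)) summable_on UNIV"
      by (subst summable_on_cong_neutral[where T = "{1}" and g = "\<lambda>_. - K v"]) auto
  qed
  also have "(\<Sum>\<^sub>\<infinity>k::nat. of_bool (k = 1) *\<^sub>R (- K v)) = - K v"
    by (subst infsum_cong_neutral[where T = "{1}" and g = "\<lambda>_. - K v"]) auto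
  also have "(\<Sum>\<^sub>\<infinity>k. 2 *\<^sub>R (c k *\<^sub>R (K ^^ k) v)) = 2 *\<^sub>R sqrt_series K v"
    unfolding sr by (rule infsum_scaleR_right)
  finally show ?thesis
    by simp
qed

text \<open>Symmetry is a separate clause because the space is real, where a nonnegative quadratic
  form does not force it. For complex-linear maps \<open>symmetric_if_real_form\<close> recovers
  it.\<close>

definition positive_map :: "('h::real_inner \<Rightarrow> 'h) \<Rightarrow> bool" where
  "positive_map R \<longleftrightarrow> bounded_linear R \<and> (\<forall>v w. inner (R v) w = inner v (R w)) \<and>
     (\<forall>v. inner v (R v) \<ge> 0)"

lemma positive_mapD:
  assumes "positive_map R"
  shows "bounded_linear R" "inner (R v) w = inner v (R w)" "inner v (R v) \<ge> 0"
  using assms by (auto simp: positive_map_def)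

lemma positive_map_Cauchy_Schwarz:
  assumes "positive_map R"
  shows "(inner v (R w))\<^sup>2 \<le> inner v (R v) * inner w (R w)"
proof -
  define a b c where "a = inner v (R v)" "b = inner v (R w)" "c = inner w (R w)"
  note R = positive_mapD[OF assms]
  note lin = bounded_linear.linear[OF R(1)]
  have b: "inner w (R v) = b"
    using R(2)[of v w] by (simp add: a_b_c_def inner_commute)
  have q: "0 \<le> a + 2 * t * b + t\<^sup>2 * c" for t
    using R(3)[of "v + t *\<^sub>R w"] b
    by (simp add: linear_add[OF lin] linear_cmul[OF lin] inner_add_left inner_add_right
        a_b_c_def power2_eq_square algebra_simps)
  have "b\<^sup>2 \<le> a * c"
  proof (cases "c = 0")
    case True
    have "b = 0"
      \<comment> \<open>With \<open>c = 0\<close> the form is affine in t, and this t gives it the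
        value -1 unless \<open>b = 0\<close>.\<close>
      using q[of "- (a + 1) / (2 * b)"] True by (cases "b = 0") (auto simp: field_simps)
    then show ?thesis
      using True by simp
  next
    case False
    then have "c > 0"
      using R(3)[of w] by (simp add: a_b_c_def)
    then show ?thesis
      \<comment> \<open>The minimum of the quadratic polynomial.\<close>
      using q[of "- b / c"] by (simp add: power2_eq_square field_simps)
  qed
  then show ?thesis
    by (simp add: a_b_c_def)
qed

lemma positive_map_eq_0:
  assumes "positive_map R" "inner v (R v) = 0"
  shows "R v = 0"
  using positive_map_Cauchy_Schwarz[OF assms(1), of "R v" v] assms(2) by simp

text \<open>This is R^2 \<le> M R: Cauchy-Schwarz for the form of \<open>R\<close> at v and R v
  gives ||R v||^4 \<le> <v, R v> M ||R v||^2, and one factor ||R v||^2 cancels.\<close>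

lemma positive_map_norm_square_le:
  assumes R: "positive_map R" and le: "\<And>v. norm (R v) \<le> M * norm v"
  shows "(norm (R v))\<^sup>2 \<le> M * inner v (R v)"
proof (cases "R v = 0")
  case False
  have "((norm (R v))\<^sup>2)\<^sup>2 = (inner v (R (R v)))\<^sup>2"
    using positive_mapD(2)[OF R, of v "R v"] by (simp add: power2_norm_eq_inner)
  also have "\<dots> \<le> inner v (R v) * inner (R v) (R (R v))"
    by (rule positive_map_Cauchy_Schwarz[OF R])
  also have "\<dots> \<le> inner v (R v) * (norm (R v) * (M * norm (R v)))"
    by (intro mult_left_mono order_trans[OF norm_cauchy_schwarz] le positive_mapD(3)[OF R]) auto
  finally have "(norm (R v))\<^sup>2 * (norm (R v))\<^sup>2 \<le> (norm (R v))\<^sup>2 * (M * inner v (R v))"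
    by (simp add: power2_eq_square mult_ac)
  then show ?thesis
    using False by (metis mult_le_cancel_left_pos zero_less_norm_iff zero_less_power)
qed (simp add: power2_eq_square)

text \<open>Brings 1 - R/M into the domain of the series. Expanding the square leaves ||v||^2 - 2
  <v, R v>/M + ||R v||^2/M^2, and R^2 \<le> M R absorbs the last term.\<close>

lemma positive_map_contraction:
  assumes R: "positive_map R" and M: "M > 0" and le: "\<And>v. norm (R v) \<le> M * norm v"
  shows "norm (v - (1 / M) *\<^sub>R R v) \<le> norm v"
proof -
  have "(norm (v - (1 / M) *\<^sub>R R v))\<^sup>2 =
        (norm v)\<^sup>2 - 2 * inner v (R v) / M + (norm (R v))\<^sup>2 / M\<^sup>2"
    unfolding power2_norm_eq_inner
    by (simp add: inner_diff_left inner_diff_right inner_commute power2_eq_square)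
  also have "\<dots> \<le> (norm v)\<^sup>2 - 2 * inner v (R v) / M + (M * inner v (R v)) / M\<^sup>2"
    by (intro add_left_mono divide_right_mono positive_map_norm_square_le[OF R le]) auto
  also have "\<dots> \<le> (norm v)\<^sup>2"
    using M positive_mapD(3)[OF R, of v] by (simp add: power2_eq_square)
  finally show ?thesis
    by (intro power2_le_imp_le[OF _ norm_ge_zero]) simp
qed

text \<open>The square root of \<open>R\<close>, provided that \<open>0 \<le> R \<le> M\<close>; it does not depend on \<open>M\<close>.\<close>

definition op_sqrt :: "real \<Rightarrow> ('h::{real_inner, banach} \<Rightarrow> 'h) \<Rightarrow> 'h \<Rightarrow> 'h" where
  "op_sqrt M R v = sqrt M *\<^sub>R (v - sqrt_series (\<lambda>w. w - (1 / M) *\<^sub>R R w) v)"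

lemma bounded_linear_one_minus:
  assumes "bounded_linear R"
  shows "bounded_linear (\<lambda>w. w - c *\<^sub>R R w)"
  by (intro bounded_linear_sub bounded_linear_ident
      bounded_linear_compose[OF bounded_linear_scaleR_right] assms)

lemma op_sqrt_intertwine:
  assumes "positive_map R" "positive_map R'" "M > 0"
    and "\<And>v. norm (R v) \<le> M * norm v" "\<And>v. norm (R' v) \<le> M * norm v"
    and Q: "bounded_linear Q" and QR: "\<And>v. Q (R v) = R' (Q v)"
  shows "Q (op_sqrt M R v) = op_sqrt M R' (Q v)"
proof -
  note lin = bounded_linear.linear[OF Q]
  have "Q (sqrt_series (\<lambda>w. w - (1 / M) *\<^sub>R R w) v) =
        sqrt_series (\<lambda>w. w - (1 / M) *\<^sub>R R' w) (Q v)"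
    by (rule sqrt_series_intertwine)
       (auto intro: positive_map_contraction assms simp: linear_diff[OF lin] linear_cmul[OF lin] QR)
  then show ?thesis
    by (simp add: op_sqrt_def linear_diff[OF lin] linear_cmul[OF lin])
qed

lemma sqrt_series_symmetric:
  assumes "\<And>v. norm (K v) \<le> norm v" and K: "\<And>v w. inner (K v) w = inner v (K w)"
  shows "inner (sqrt_series K v) w = inner v (sqrt_series K w)"
proof -
  have "inner ((K ^^ n) v) w = inner v ((K ^^ n) w)" for n v w
  proof (induction n arbitrary: w)
    case (Suc n)
    have "inner ((K ^^ Suc n) v) w = inner v ((K ^^ n) (K w))"
      by (simp add: K Suc)
    then show ?case
      by (simp add: funpow_swap1)
  qed simp
  then show ?thesis
    unfolding sqrt_series_def
    by (simp add: bounded_linear.suminf[OF bounded_linear_inner_left summable_sqrt_series[OF assms(1)]]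
        bounded_linear.suminf[OF bounded_linear_inner_right summable_sqrt_series[OF assms(1)]])
qed

text \<open>Let K = 1 - R/M and let D be the series at K. The square of sqrt M (1 - D) is M (1 - 2 D
  + D^2) = M (1 - K) = R, and positivity follows from ||D|| \<le> 1.\<close>

lemma op_sqrt:
  assumes R: "positive_map R" and M: "M > 0" and le: "\<And>v. norm (R v) \<le> M * norm v"
  shows "positive_map (op_sqrt M R)" and "op_sqrt M R (op_sqrt M R v) = R v"
proof -
  define K where "K = (\<lambda>w. w - (1 / M) *\<^sub>R R w)"
  have Kle: "norm (K v) \<le> norm v" for v
    unfolding K_def by (rule positive_map_contraction[OF R M le])
  have K: "bounded_linear K"
    unfolding K_def by (rule bounded_linear_one_minus[OF positive_mapD(1)[OF R]])
  have S: "op_sqrt M R = (\<lambda>v. sqrt M *\<^sub>R (v - sqrt_series K v))"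
    by (simp add: fun_eq_iff op_sqrt_def K_def)
  have D: "bounded_linear (sqrt_series K)"
    by (rule bounded_linear_sqrt_series[OF K Kle])
  note lin = bounded_linear.linear[OF D]
  have "inner (K v) w = inner v (K w)" for v w
    by (simp add: K_def inner_diff_left inner_diff_right positive_mapD(2)[OF R])
  then have sym: "inner (sqrt_series K v) w = inner v (sqrt_series K w)" for v w
    by (rule sqrt_series_symmetric[OF Kle])
  have "inner v (sqrt_series K v) \<le> inner v v" for v
    using norm_cauchy_schwarz[of v "sqrt_series K v"] mult_left_mono[OF norm_sqrt_series_le[OF Kle, of v], of "norm v"]
    by (simp add: power2_norm_eq_inner[symmetric] power2_eq_square)
  then show "positive_map (op_sqrt M R)"
    unfolding positive_map_def S
    using M by (auto intro!: bounded_linear_sub bounded_linear_ident D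
      bounded_linear_compose[OF bounded_linear_scaleR_right]
      simp: inner_diff_left inner_diff_right sym)
  have "op_sqrt M R (op_sqrt M R v) = M *\<^sub>R (v - K v)"
    using M by (simp add: S linear_diff[OF lin] linear_cmul[OF lin]
        sqrt_series_quadratic[OF K Kle] scaleR_2 algebra_simps)
  then show "op_sqrt M R (op_sqrt M R v) = R v"
    using M by (simp add: K_def)
qed

text \<open>Any square root commutes with \<open>R\<close>, hence with \<open>op_sqrt M R\<close>; so the difference \<open>w\<close> of the two
  values at a vector is annihilated by both roots.\<close>

lemma op_sqrt_unique:
  assumes R: "positive_map R" and M: "M > 0" and le: "\<And>v. norm (R v) \<le> M * norm v"
    and S: "positive_map S" and SS: "\<And>v. S (S v) = R v"
  shows "S = op_sqrt M R"
proof
  fix v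
  define T where "T = op_sqrt M R"
  have T: "positive_map T" and TT: "\<And>v. T (T v) = R v"
    unfolding T_def using op_sqrt[OF R M le] by auto
  have ST: "S (T u) = T (S u)" for u
    unfolding T_def
    by (rule op_sqrt_intertwine[OF R R M le le positive_mapD(1)[OF S]]) (simp flip: SS)
  note linS = bounded_linear.linear[OF positive_mapD(1)[OF S]]
  note linT = bounded_linear.linear[OF positive_mapD(1)[OF T]]
  define w where "w = S v - T v"
  \<comment> \<open>(S + T)(S - T) v = S (S v) - T (T v) because the two roots commute. A vanishing
    sum of two nonnegative forms then kills each of them.\<close>
  have "S w + T w = 0"
    by (simp add: w_def linear_diff[OF linS] linear_diff[OF linT] SS TT ST)
  then have "inner w (S w) + inner w (T w) = 0"
    by (simp flip: inner_add_right)
  then have "inner w (S w) = 0" "inner w (T w) = 0"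
    using positive_mapD(3)[OF S, of w] positive_mapD(3)[OF T, of w] by linarith+
  then have 0: "S w = 0" "T w = 0"
    using positive_map_eq_0 S T by auto
  have "inner w w = inner w (S v) - inner w (T v)"
    by (simp add: w_def inner_diff_right)
  also have "\<dots> = inner (S w) v - inner (T w) v"
    by (simp add: positive_mapD(2)[OF S] positive_mapD(2)[OF T])
  finally have "w = 0"
    by (simp add: 0)
  then show "S v = op_sqrt M R v"
    by (simp add: w_def T_def)
qed

lemma positive_map_adjoint_compose:
  assumes "bounded_linear F" "bounded_linear F'" "\<And>v w. inner (F v) w = inner v (F' w)"
  shows "positive_map (\<lambda>v. F' (F v))"
  using bounded_linear_compose[OF assms(2,1)]
  by (auto simp: positive_map_def assms(3)[symmetric])
     (metis assms(3) inner_commute)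

text \<open>For \<open>S = |F|\<close>, both bounds come from expanding $\sum_i\|Sd_i-tp_i\|^2\ge0$. Since \<open>S\<close> and \<open>F\<close> have the
  same kernel, $\langle d_i,Sd_i\rangle=\langle Sd_i,p_i\rangle$.\<close>

lemma
  assumes S: "positive_map S" and SS: "\<And>v. S (S v) = F' (F v)"
    and F: "bounded_linear F" and adj: "\<And>v w. inner (F v) w = inner v (F' w)"
    and Fp: "\<And>i. i \<in> I \<Longrightarrow> F (p i) = F (d i)" and t: "t > 0"
  shows sum_inner_abs_le:
      "2 * t * (\<Sum>i\<in>I. inner (d i) (S (d i))) \<le> (\<Sum>i\<in>I. (norm (F (d i)))\<^sup>2) + t\<^sup>2 * (\<Sum>i\<in>I. (norm (p i))\<^sup>2)"
    and sum_inner_abs_less: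
      "\<lbrakk>finite I; \<exists>i\<in>I. F' (F (d i)) \<noteq> t\<^sup>2 *\<^sub>R p i\<rbrakk> \<Longrightarrow>
      2 * t * (\<Sum>i\<in>I. inner (d i) (S (d i))) < (\<Sum>i\<in>I. (norm (F (d i)))\<^sup>2) + t\<^sup>2 * (\<Sum>i\<in>I. (norm (p i))\<^sup>2)"
proof -
  note linS = bounded_linear.linear[OF positive_mapD(1)[OF S]]
  note linF = bounded_linear.linear[OF F]
  have SF: "inner (S v) (S v) = inner (F v) (F v)" for v
    by (simp add: positive_mapD(2)[OF S] SS adj)
  have "S (d i) = S (p i)" if "i \<in> I" for i
    using SF[of "d i - p i"] Fp[OF that] by (simp add: linear_diff[OF linS] linear_diff[OF linF])
  note Sp = this
  have "(norm (S (d i) - t *\<^sub>R p i))\<^sup>2 =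
      (norm (F (d i)))\<^sup>2 - 2 * t * inner (d i) (S (d i)) + t\<^sup>2 * (norm (p i))\<^sup>2" if "i \<in> I" for i
  proof -
    have "inner (S (d i)) (p i) = inner (d i) (S (d i))"
      using positive_mapD(2)[OF S, of "d i" "p i"] Sp[OF that] by simp
    then show ?thesis
      using SF[of "d i"] unfolding power2_norm_eq_inner
      by (simp add: inner_diff_left inner_diff_right inner_commute power2_eq_square)
  qed
  then have *: "(\<Sum>i\<in>I. (norm (S (d i) - t *\<^sub>R p i))\<^sup>2) = (\<Sum>i\<in>I. (norm (F (d i)))\<^sup>2)
      - 2 * t * (\<Sum>i\<in>I. inner (d i) (S (d i))) + t\<^sup>2 * (\<Sum>i\<in>I. (norm (p i))\<^sup>2)"
    by (simp add: sum.distrib sum_subtractf sum_distrib_left)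
  have "0 \<le> (\<Sum>i\<in>I. (norm (S (d i) - t *\<^sub>R p i))\<^sup>2)"
    by (intro sum_nonneg) auto
  with * show "2 * t * (\<Sum>i\<in>I. inner (d i) (S (d i))) \<le> (\<Sum>i\<in>I. (norm (F (d i)))\<^sup>2) + t\<^sup>2 * (\<Sum>i\<in>I. (norm (p i))\<^sup>2)"
    by linarith
  assume fin: "finite I" and "\<exists>i\<in>I. F' (F (d i)) \<noteq> t\<^sup>2 *\<^sub>R p i"
  then obtain i where i: "i \<in> I" "F' (F (d i)) \<noteq> t\<^sup>2 *\<^sub>R p i"
    by auto
  \<comment> \<open>The equality case: applying \<open>S\<close> once more and replacing S p_i by S
    d_i would give F^*F d_i = t^2 p_i.\<close>
  have "S (d i) \<noteq> t *\<^sub>R p i"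
  proof
    assume eq: "S (d i) = t *\<^sub>R p i"
    have "S (S (d i)) = S (t *\<^sub>R p i)"
      by (simp only: eq)
    also have "\<dots> = t *\<^sub>R S (d i)"
      by (simp add: linear_cmul[OF linS] Sp[OF i(1)])
    also have "\<dots> = t\<^sup>2 *\<^sub>R p i"
      by (simp add: eq power2_eq_square)
    finally show False
      using i(2) by (simp add: SS)
  qed
  then have "0 < (\<Sum>i\<in>I. (norm (S (d i) - t *\<^sub>R p i))\<^sup>2)"
    using i(1) by (intro sum_pos2[OF fin]) auto
  with * show "2 * t * (\<Sum>i\<in>I. inner (d i) (S (d i))) < (\<Sum>i\<in>I. (norm (F (d i)))\<^sup>2) + t\<^sup>2 * (\<Sum>i\<in>I. (norm (p i))\<^sup>2)"
    by linarith
qed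

section \<open>The Hilbert space of square-summable functions\<close>

text \<open>Members of \<open>ell2 I\<close> vanish off \<open>I\<close>, so all these spaces lie in
  \<open>ell2 UNIV\<close>; this lets one type serve every index set.\<close>

lemma ell2_iff: "f \<in> ell2 I \<longleftrightarrow> f \<in> ell2 UNIV \<and> (\<forall>i. i \<notin> I \<longrightarrow> f i = 0)"
proof -
  have "(\<lambda>i. (cmod (f i))\<^sup>2) summable_on I \<longleftrightarrow> (\<lambda>i. (cmod (f i))\<^sup>2) summable_on UNIV"
    if "\<forall>i. i \<notin> I \<longrightarrow> f i = 0"
    by (rule summable_on_cong_neutral) (use that in auto)
  then show ?thesis
    by (auto simp: ell2_def)
qed

lemma ell2_UNIV_I:
  assumes "\<And>F. finite F \<Longrightarrow> (\<Sum>i\<in>F. (cmod (f i))\<^sup>2) \<le> B"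
  shows "f \<in> ell2 UNIV"
  unfolding ell2_def
  using assms by (auto intro!: nonneg_bdd_above_summable_on bdd_aboveI2)

lemma ell2_add:
  assumes "f \<in> ell2 UNIV" "g \<in> ell2 UNIV"
  shows "(\<lambda>i. f i + g i) \<in> ell2 UNIV"
proof -
  have "(\<lambda>i. 2 * (cmod (f i))\<^sup>2 + 2 * (cmod (g i))\<^sup>2) summable_on UNIV"
    using assms by (auto simp: ell2_def intro!: summable_on_add summable_on_cmult_right)
  then have "(\<lambda>i. (cmod (f i + g i))\<^sup>2) summable_on UNIV"
  proof (rule summable_on_comparison_test)
    fix i
    have "(cmod (f i + g i))\<^sup>2 \<le> (cmod (f i) + cmod (g i))\<^sup>2"
      by (intro power_mono norm_triangle_ineq) auto
    also have "\<dots> \<le> 2 * (cmod (f i))\<^sup>2 + 2 * (cmod (g i))\<^sup>2"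
      using zero_le_power2[of "cmod (f i) - cmod (g i)"] by (simp add: power2_sum power2_diff)
    finally show "(cmod (f i + g i))\<^sup>2 \<le> 2 * (cmod (f i))\<^sup>2 + 2 * (cmod (g i))\<^sup>2" .
  qed auto
  then show ?thesis
    by (simp add: ell2_def)
qed

lemma ell2_cmult:
  assumes "f \<in> ell2 UNIV"
  shows "(\<lambda>i. a * f i) \<in> ell2 UNIV"
  using assms
  by (auto simp: ell2_def norm_mult power_mult_distrib intro!: summable_on_cmult_right)

lemma ell2_mult_summable:
  assumes "f \<in> ell2 UNIV" "g \<in> ell2 UNIV"
  shows "(\<lambda>i. cnj (f i) * g i) summable_on UNIV"
proof (rule abs_summable_summable)
  have "(\<lambda>i. (cmod (f i))\<^sup>2 + (cmod (g i))\<^sup>2) summable_on UNIV"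
    using assms by (auto simp: ell2_def intro!: summable_on_add)
  then show "(\<lambda>i. norm (cnj (f i) * g i)) summable_on UNIV"
  proof (rule summable_on_comparison_test)
    fix i
    show "norm (cnj (f i) * g i) \<le> (cmod (f i))\<^sup>2 + (cmod (g i))\<^sup>2"
      using zero_le_power2[of "cmod (f i) - cmod (g i)"] zero_le_power2[of "cmod (f i)"]
        zero_le_power2[of "cmod (g i)"]
      unfolding norm_mult complex_mod_cnj power2_diff by linarith
  qed auto
qed

lemma Re_ell2_inner_self:
  assumes "f \<in> ell2 UNIV"
  shows "Re (ell2_inner UNIV f f) = (\<Sum>\<^sub>\<infinity>i. (cmod (f i))\<^sup>2)"
  unfolding ell2_inner_def infsum_Re[OF ell2_mult_summable[OF assms assms], symmetric]
  by (simp add: cmod_power2 flip: power2_eq_square)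

text \<open>The classes \<open>real_inner\<close> and \<open>banach\<close> need a type, which
  cannot depend on the set \<open>I\<close>; \<open>ell2 I\<close> is therefore treated as the range
  of the projection \<open>l2_cut I\<close>.\<close>

typedef 'i l2 = "ell2 (UNIV :: 'i set)" morphisms l2_fun Abs_l2
  by (rule exI[of _ "\<lambda>_. 0"]) (simp add: ell2_def)

setup_lifting type_definition_l2

instantiation l2 :: (type) real_inner
begin

lift_definition zero_l2 :: "'a l2" is "\<lambda>_. 0"
  by (simp add: ell2_def)

lift_definition plus_l2 :: "'a l2 \<Rightarrow> 'a l2 \<Rightarrow> 'a l2" is "\<lambda>f g i. f i + g i"
  by (rule ell2_add)

lift_definition uminus_l2 :: "'a l2 \<Rightarrow> 'a l2" is "\<lambda>f i. - f i"
  using ell2_cmult[of _ "-1"] by simp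

lift_definition minus_l2 :: "'a l2 \<Rightarrow> 'a l2 \<Rightarrow> 'a l2" is "\<lambda>f g i. f i - g i"
  using ell2_add[OF _ ell2_cmult[of _ "-1"]] by simp

lift_definition scaleR_l2 :: "real \<Rightarrow> 'a l2 \<Rightarrow> 'a l2" is "\<lambda>r f i. complex_of_real r * f i"
  by (rule ell2_cmult)

definition inner_l2 :: "'a l2 \<Rightarrow> 'a l2 \<Rightarrow> real" where
  "inner_l2 v w = Re (ell2_inner UNIV (l2_fun v) (l2_fun w))"

definition norm_l2 :: "'a l2 \<Rightarrow> real" where
  "norm_l2 v = sqrt (inner v v)"

definition sgn_l2 :: "'a l2 \<Rightarrow> 'a l2" where
  "sgn_l2 v = inverse (norm v) *\<^sub>R v"

definition dist_l2 :: "'a l2 \<Rightarrow> 'a l2 \<Rightarrow> real" where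
  "dist_l2 v w = norm (v - w)"

definition uniformity_l2 :: "('a l2 \<times> 'a l2) filter" where
  "uniformity_l2 = (INF e\<in>{0<..}. principal {(x, y). dist x y < e})"

definition open_l2 :: "'a l2 set \<Rightarrow> bool" where
  "open_l2 U \<longleftrightarrow> (\<forall>x\<in>U. \<forall>\<^sub>F (x', y) in uniformity. x' = x \<longrightarrow> y \<in> U)"

instance
proof
  fix u v w :: "'a l2" and r s :: real and U :: "'a l2 set"
  show "u + v + w = u + (v + w)" "u + v = v + u" "0 + u = u" "- u + u = 0" "u - v = u + - v"
    "r *\<^sub>R (u + v) = r *\<^sub>R u + r *\<^sub>R v" "(r + s) *\<^sub>R u = r *\<^sub>R u + s *\<^sub>R u"
    "r *\<^sub>R s *\<^sub>R u = (r * s) *\<^sub>R u" "1 *\<^sub>R u = u"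
    by (transfer; simp add: algebra_simps)+
  show "sgn u = inverse (norm u) *\<^sub>R u" "dist u v = norm (u - v)" "norm u = sqrt (inner u u)"
    by (simp_all add: sgn_l2_def dist_l2_def norm_l2_def)
  show "uniformity = (INF e\<in>{0<..}. principal {(x, y::'a l2). dist x y < e})"
    by (rule uniformity_l2_def)
  show "open U \<longleftrightarrow> (\<forall>x\<in>U. \<forall>\<^sub>F (x', y) in uniformity. x' = x \<longrightarrow> y \<in> U)"
    by (rule open_l2_def)
  note sm = ell2_mult_summable[OF l2_fun l2_fun]
  show "inner u v = inner v u"
  proof -
    have "cnj (ell2_inner UNIV (l2_fun u) (l2_fun v)) = ell2_inner UNIV (l2_fun v) (l2_fun u)"
      unfolding ell2_inner_def infsum_cnj[symmetric] by (simp add: mult.commute)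
    then show ?thesis
      unfolding inner_l2_def by (metis complex_cnj(1) complex.sel(1) cnj.simps(1))
  qed
  show "inner (u + v) w = inner u w + inner v w"
    by (simp add: inner_l2_def ell2_inner_def plus_l2.rep_eq distrib_right infsum_add[OF sm sm])
  show "inner (r *\<^sub>R u) v = r * inner u v"
    by (simp add: inner_l2_def ell2_inner_def scaleR_l2.rep_eq mult.assoc infsum_cmult_right')
  have nn: "inner u u = (\<Sum>\<^sub>\<infinity>i. (cmod (l2_fun u i))\<^sup>2)"
    unfolding inner_l2_def by (rule Re_ell2_inner_self[OF l2_fun])
  then show "0 \<le> inner u u"
    by (simp add: infsum_nonneg)
  show "inner u u = 0 \<longleftrightarrow> u = 0"
  proof
    assume "inner u u = 0"
    moreover have "(\<lambda>i. (cmod (l2_fun u i))\<^sup>2) summable_on UNIV"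
      using l2_fun[of u] by (simp add: ell2_def)
    ultimately have "(cmod (l2_fun u i))\<^sup>2 = 0" for i
      using nn by (intro nonneg_infsum_le_0D[where A = UNIV]) auto
    then show "u = 0"
      by (simp add: l2_fun_inject[symmetric] zero_l2.rep_eq fun_eq_iff)
  qed (simp add: inner_l2_def ell2_inner_def zero_l2.rep_eq)
qed

end

lemma l2_norm_square: "(norm v)\<^sup>2 = (\<Sum>\<^sub>\<infinity>i. (cmod (l2_fun v i))\<^sup>2)"
  unfolding power2_norm_eq_inner[of v] inner_l2_def by (rule Re_ell2_inner_self[OF l2_fun])

lemma l2_norm_eq: "norm v = ell2_norm UNIV (l2_fun v)"
  by (simp add: ell2_norm_def l2_norm_square[symmetric])

lemma l2_sum_le_norm:
  assumes "finite F"
  shows "(\<Sum>i\<in>F. (cmod (l2_fun v i))\<^sup>2) \<le> (norm v)\<^sup>2"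
  using l2_fun[of v] assms unfolding l2_norm_square
  by (intro finite_sum_le_infsum) (auto simp: ell2_def)

lemma l2_norm_leI:
  assumes "B \<ge> 0" "\<And>F. finite F \<Longrightarrow> (\<Sum>i\<in>F. (cmod (l2_fun v i))\<^sup>2) \<le> B\<^sup>2"
  shows "norm v \<le> B"
proof -
  have "(norm v)\<^sup>2 \<le> B\<^sup>2"
    unfolding l2_norm_square using l2_fun[of v] assms(2)
    by (intro infsum_le_finite_sums) (auto simp: ell2_def)
  then show ?thesis
    using assms(1) by (rule power2_le_imp_le)
qed

lemma cmod_l2_fun_le: "cmod (l2_fun v i) \<le> norm v"
  using l2_sum_le_norm[of "{i}" v] by (auto intro: power2_le_imp_le)

instance l2 :: (type) banach
proof
  fix X :: "nat \<Rightarrow> 'a l2"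
  assume X: "Cauchy X"
  have "Cauchy (\<lambda>n. l2_fun (X n) i)" for i
  proof (rule CauchyI)
    fix e :: real assume "e > 0"
    then obtain N where N: "\<forall>m\<ge>N. \<forall>n\<ge>N. norm (X m - X n) < e"
      using CauchyD[OF X] by blast
    have "norm (l2_fun (X m) i - l2_fun (X n) i) \<le> norm (X m - X n)" for m n
      using cmod_l2_fun_le[of "X m - X n" i] by (simp add: minus_l2.rep_eq)
    then show "\<exists>N. \<forall>m\<ge>N. \<forall>n\<ge>N. norm (l2_fun (X m) i - l2_fun (X n) i) < e"
      using N by (meson le_less_trans)
  qed
  then have "\<forall>i. \<exists>x. (\<lambda>n. l2_fun (X n) i) \<longlonglongrightarrow> x"
    using Cauchy_convergent convergent_def by blast
  then obtain x where x: "\<And>i. (\<lambda>n. l2_fun (X n) i) \<longlonglongrightarrow> x i"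
    by metis
  \<comment> \<open>Stated for finite sums, where the limit in the second index is taken term by
    term. Uniformity in \<open>F\<close> then yields both the membership of the limit and
    convergence in norm.\<close>
  have bound: "\<exists>N. \<forall>n\<ge>N. \<forall>F. finite F \<longrightarrow> (\<Sum>i\<in>F. (cmod (l2_fun (X n) i - x i))\<^sup>2) \<le> e\<^sup>2"
    if e: "e > 0" for e
  proof -
    obtain N where N: "\<forall>m\<ge>N. \<forall>n\<ge>N. norm (X m - X n) < e"
      using CauchyD[OF X e] by blast
    have "(\<Sum>i\<in>F. (cmod (l2_fun (X n) i - x i))\<^sup>2) \<le> e\<^sup>2" if "n \<ge> N" "finite F" for n F
    proof (rule LIMSEQ_le_const2)
      show "(\<lambda>m. \<Sum>i\<in>F. (cmod (l2_fun (X n) i - l2_fun (X m) i))\<^sup>2) \<longlonglongrightarrow>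
            (\<Sum>i\<in>F. (cmod (l2_fun (X n) i - x i))\<^sup>2)"
        by (intro tendsto_intros x)
      have "(\<Sum>i\<in>F. (cmod (l2_fun (X n) i - l2_fun (X m) i))\<^sup>2) \<le> e\<^sup>2" if "m \<ge> N" for m
      proof -
        have "(\<Sum>i\<in>F. (cmod (l2_fun (X n) i - l2_fun (X m) i))\<^sup>2) \<le> (norm (X n - X m))\<^sup>2"
          using l2_sum_le_norm[OF \<open>finite F\<close>, of "X n - X m"] by (simp add: minus_l2.rep_eq)
        also have "\<dots> \<le> e\<^sup>2"
          using N \<open>n \<ge> N\<close> \<open>m \<ge> N\<close> by (intro power_mono) (auto intro: less_imp_le)
        finally show ?thesis .
      qed
      then show "\<exists>N. \<forall>m\<ge>N. (\<Sum>i\<in>F. (cmod (l2_fun (X n) i - l2_fun (X m) i))\<^sup>2) \<le> e\<^sup>2"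
        by blast
    qed
    then show ?thesis
      by blast
  qed
  obtain n where "\<And>F. finite F \<Longrightarrow> (\<Sum>i\<in>F. (cmod (l2_fun (X n) i - x i))\<^sup>2) \<le> 1\<^sup>2"
    using bound[of 1] by auto
  then have "(\<lambda>i. l2_fun (X n) i - x i) \<in> ell2 UNIV"
    by (rule ell2_UNIV_I)
  from ell2_add[OF l2_fun[of "X n"] ell2_cmult[OF this, of "-1"]]
  have "x \<in> ell2 UNIV"
    by simp
  then have Lx: "l2_fun (Abs_l2 x) = x"
    by (rule Abs_l2_inverse)
  have "X \<longlonglongrightarrow> Abs_l2 x"
  proof (rule LIMSEQ_I)
    fix e :: real assume "e > 0"
    then obtain N where N: "\<And>n F. n \<ge> N \<Longrightarrow> finite F \<Longrightarrow>
        (\<Sum>i\<in>F. (cmod (l2_fun (X n) i - x i))\<^sup>2) \<le> (e / 2)\<^sup>2"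
      using bound[of "e / 2"] by auto
    have "norm (X n - Abs_l2 x) \<le> e / 2" if "n \<ge> N" for n
      using N[OF that] \<open>e > 0\<close> by (intro l2_norm_leI) (auto simp: minus_l2.rep_eq Lx)
    then show "\<exists>N. \<forall>n\<ge>N. norm (X n - Abs_l2 x) < e"
      using \<open>e > 0\<close> by (intro exI[of _ N]) fastforce
  qed
  then show "convergent X"
    by (auto simp: convergent_def)
qed

section \<open>Complex scalars, basis vectors and partial composition on \<open>l2\<close>\<close>

lift_definition l2_scale :: "complex \<Rightarrow> 'i l2 \<Rightarrow> 'i l2" is "\<lambda>a f i. a * f i"
  by (rule ell2_cmult)

lift_definition l2_delta :: "'i \<Rightarrow> 'i l2" is "\<lambda>a h. of_bool (h = a)"
  by (rule delta_in_ell2) simp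

lemma bounded_linear_l2_scale: "bounded_linear (l2_scale a :: 'i l2 \<Rightarrow> 'i l2)"
proof (rule bounded_linear_intro[of _ "cmod a"])
  show "norm (l2_scale a v) \<le> norm v * cmod a" for v :: "'i l2"
  proof (rule l2_norm_leI)
    fix F :: "'i set" assume "finite F"
    then have "(cmod a)\<^sup>2 * (\<Sum>i\<in>F. (cmod (l2_fun v i))\<^sup>2) \<le> (cmod a)\<^sup>2 * (norm v)\<^sup>2"
      by (intro mult_left_mono l2_sum_le_norm) auto
    then show "(\<Sum>i\<in>F. (cmod (l2_fun (l2_scale a v) i))\<^sup>2) \<le> (norm v * cmod a)\<^sup>2"
      by (simp add: l2_scale.rep_eq norm_mult power_mult_distrib sum_distrib_left mult.commute)
  qed simp
qed (transfer; simp add: algebra_simps)+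

lemma l2_scale_scale: "l2_scale a (l2_scale b v) = l2_scale (a * b) v"
  by transfer (simp add: mult.assoc)

lemma l2_scale_of_real: "l2_scale (of_real r) v = r *\<^sub>R v"
  by transfer simp

lemma inner_l2_scale: "inner (l2_scale a v) w = inner v (l2_scale (cnj a) w)"
  by (simp add: inner_l2_def ell2_inner_def l2_scale.rep_eq mult_ac)

text \<open>Since <i v, w> = -i <v, w>, the imaginary part of the complex inner product is again a
  real inner product; a complex identity thus becomes two real ones.\<close>

lemma ell2_inner_l2:
  "ell2_inner UNIV (l2_fun v) (l2_fun w) = Complex (inner v w) (inner (l2_scale \<i> v) w)"
proof -
  have "ell2_inner UNIV (l2_fun (l2_scale \<i> v)) (l2_fun w) = - \<i> * ell2_inner UNIV (l2_fun v) (l2_fun w)"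
    unfolding ell2_inner_def infsum_cmult_right'[symmetric]
    by (simp add: l2_scale.rep_eq mult_ac)
  then show ?thesis
    by (simp add: inner_l2_def complex_eq_iff)
qed

lemma inner_l2_delta: "inner (l2_delta a) v = Re (l2_fun v a)"
  by (simp add: inner_l2_def l2_delta.rep_eq delta_inner)

lemma inner_l2_delta_delta: "inner (l2_delta a) (l2_delta b) = of_bool (a = b)"
  by (simp add: inner_l2_delta l2_delta.rep_eq)

lemma l2_eqI_inner:
  assumes "\<And>u. inner u v = inner u w"
  shows "v = w"
proof -
  have "inner (v - w) (v - w) = 0"
    using assms[of "v - w"] by (simp add: inner_diff_right)
  then show ?thesis
    by simp
qed

text \<open>One construction for coordinate cuts, for matrix units times translations, and for right
  translations. Injectivity of \<open>\<phi>\<close> on \<open>D\<close> makes it a contraction, and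
  the inverse of \<open>\<phi>\<close> gives its adjoint.\<close>

definition l2_comp :: "'i set \<Rightarrow> ('i \<Rightarrow> 'j) \<Rightarrow> 'j l2 \<Rightarrow> 'i l2" where
  "l2_comp D \<phi> v = Abs_l2 (\<lambda>i. if i \<in> D then l2_fun v (\<phi> i) else 0)"

lemma sum_l2_comp_le:
  assumes "inj_on \<phi> D" "finite F"
  shows "(\<Sum>i\<in>F. (cmod (if i \<in> D then l2_fun v (\<phi> i) else 0))\<^sup>2) \<le> (norm v)\<^sup>2"
proof -
  have "(\<Sum>i\<in>F. (cmod (if i \<in> D then l2_fun v (\<phi> i) else 0))\<^sup>2) =
        (\<Sum>i\<in>F \<inter> D. (cmod (l2_fun v (\<phi> i)))\<^sup>2)"
    using assms(2) by (intro sum.mono_neutral_cong_right) auto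
  also have "\<dots> = (\<Sum>k\<in>\<phi> ` (F \<inter> D). (cmod (l2_fun v k))\<^sup>2)"
    using inj_on_subset[OF assms(1), of "F \<inter> D"] by (subst sum.reindex) auto
  also have "\<dots> \<le> (norm v)\<^sup>2"
    using assms(2) by (intro l2_sum_le_norm) auto
  finally show ?thesis .
qed

lemma l2_fun_comp:
  assumes "inj_on \<phi> D"
  shows "l2_fun (l2_comp D \<phi> v) = (\<lambda>i. if i \<in> D then l2_fun v (\<phi> i) else 0)"
  unfolding l2_comp_def using sum_l2_comp_le[OF assms]
  by (intro Abs_l2_inverse ell2_UNIV_I) auto

lemma bounded_linear_l2_comp:
  assumes "inj_on \<phi> D"
  shows "bounded_linear (l2_comp D \<phi>)"
proof (rule bounded_linear_intro[of _ 1])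
  show "norm (l2_comp D \<phi> v) \<le> norm v * 1" for v
    using sum_l2_comp_le[OF assms] by (intro l2_norm_leI) (auto simp: l2_fun_comp[OF assms])
qed (auto simp: l2_fun_inject[symmetric] l2_fun_comp[OF assms] plus_l2.rep_eq scaleR_l2.rep_eq)

lemma l2_comp_scale:
  assumes "inj_on \<phi> D"
  shows "l2_comp D \<phi> (l2_scale a v) = l2_scale a (l2_comp D \<phi> v)"
  by (auto simp: l2_fun_inject[symmetric] l2_fun_comp[OF assms] l2_scale.rep_eq)

lemma inner_l2_comp:
  assumes \<phi>: "bij_betw \<phi> D E" and \<psi>: "\<And>i. i \<in> D \<Longrightarrow> \<psi> (\<phi> i) = i"
  shows "inner (l2_comp D \<phi> v) w = inner v (l2_comp E \<psi> w)"
proof -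
  have \<psi>': "inj_on \<psi> E"
    using bij_betw_byWitness \<phi> \<psi> by (auto simp: bij_betw_def inj_on_def)
  have "(\<Sum>\<^sub>\<infinity>i. cnj (if i \<in> D then l2_fun v (\<phi> i) else 0) * l2_fun w i) =
        (\<Sum>\<^sub>\<infinity>i\<in>D. cnj (l2_fun v (\<phi> i)) * l2_fun w (\<psi> (\<phi> i)))"
    by (rule infsum_cong_neutral) (auto simp: \<psi>)
  also have "\<dots> = (\<Sum>\<^sub>\<infinity>k\<in>E. cnj (l2_fun v k) * l2_fun w (\<psi> k))"
    by (rule infsum_reindex_bij_betw[OF \<phi>])
  also have "\<dots> = (\<Sum>\<^sub>\<infinity>k. cnj (l2_fun v k) * (if k \<in> E then l2_fun w (\<psi> k) else 0))"
    by (rule infsum_cong_neutral) auto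
  finally show ?thesis
    using \<phi> by (simp add: inner_l2_def ell2_inner_def l2_fun_comp \<psi>' bij_betw_def)
qed

section \<open>Operators on subspaces $\ell_2(I)$\<close>

abbreviation l2_cut :: "'i set \<Rightarrow> 'i l2 \<Rightarrow> 'i l2" where
  "l2_cut I \<equiv> l2_comp I (\<lambda>i. i)"

lemma l2_fun_cut: "l2_fun (l2_cut I v) = (\<lambda>i. if i \<in> I then l2_fun v i else 0)"
  by (rule l2_fun_comp) simp

lemma inner_l2_cut: "inner (l2_cut I v) w = inner v (l2_cut I w)"
  by (rule inner_l2_comp) (simp_all add: bij_betw_def)

lemma l2_cut_in_ell2: "l2_fun (l2_cut I v) \<in> ell2 I"
  using l2_fun[of "l2_cut I v"] by (simp add: ell2_iff[of _ I]) (simp add: l2_fun_cut)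

lemma l2_cut_Abs:
  assumes "f \<in> ell2 I"
  shows "l2_cut I (Abs_l2 f) = Abs_l2 f" "l2_fun (Abs_l2 f) = f"
proof -
  show *: "l2_fun (Abs_l2 f) = f"
    using assms by (intro Abs_l2_inverse) (simp add: ell2_iff[of _ I])
  show "l2_cut I (Abs_l2 f) = Abs_l2 f"
    using assms by (auto simp: l2_fun_inject[symmetric] l2_fun_cut * ell2_iff[of _ I])
qed

lemma ell2_inner_UNIV:
  assumes "f \<in> ell2 I"
  shows "ell2_inner I f g = ell2_inner UNIV f g"
  unfolding ell2_inner_def by (rule infsum_cong_neutral) (use assms in \<open>auto simp: ell2_def\<close>)

lemma ell2_norm_UNIV:
  assumes "f \<in> ell2 I"
  shows "ell2_norm I f = ell2_norm UNIV f"
  unfolding ell2_norm_def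
  by (intro arg_cong[where f = sqrt] infsum_cong_neutral) (use assms in \<open>auto simp: ell2_def\<close>)

text \<open>A bounded operator on $\ell_2(I)$, extended by \<open>0\<close> to the orthogonal complement.\<close>

definition l2_operator :: "'i set \<Rightarrow> ('i l2 \<Rightarrow> 'i l2) \<Rightarrow> bool" where
  "l2_operator I F \<longleftrightarrow> bounded_linear F \<and> (\<forall>a v. F (l2_scale a v) = l2_scale a (F v)) \<and>
     (\<forall>v. F (l2_cut I v) = F v) \<and> (\<forall>v. l2_cut I (F v) = F v)"

lemma l2_operatorD:
  assumes "l2_operator I F"
  shows "bounded_linear F" "F (l2_scale a v) = l2_scale a (F v)" "F (l2_cut I v) = F v"
    "l2_cut I (F v) = F v"
  using assms by (auto simp: l2_operator_def)

definition l2_restrict :: "'i set \<Rightarrow> ('i l2 \<Rightarrow> 'i l2) \<Rightarrow> ('i \<Rightarrow> complex) \<Rightarrow> ('i \<Rightarrow> complex)" where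
  "l2_restrict I F = (\<lambda>f\<in>ell2 I. l2_fun (F (Abs_l2 f)))"

definition l2_extend :: "'i set \<Rightarrow> (('i \<Rightarrow> complex) \<Rightarrow> ('i \<Rightarrow> complex)) \<Rightarrow> 'i l2 \<Rightarrow> 'i l2" where
  "l2_extend I T v = Abs_l2 (T (l2_fun (l2_cut I v)))"

lemma l2_restrict_in_ell2:
  assumes "l2_operator I F" "f \<in> ell2 I"
  shows "l2_restrict I F f \<in> ell2 I"
  using l2_cut_in_ell2[of I "F (Abs_l2 f)"] assms by (simp add: l2_restrict_def l2_operatorD)

lemma Abs_l2_add:
  assumes "f \<in> ell2 I" "g \<in> ell2 I"
  shows "Abs_l2 (\<lambda>i. f i + g i) = Abs_l2 f + Abs_l2 g" "(\<lambda>i. f i + g i) \<in> ell2 I"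
proof -
  show *: "(\<lambda>i. f i + g i) \<in> ell2 I"
    using assms ell2_add[of f g] by (simp add: ell2_iff[of _ I])
  show "Abs_l2 (\<lambda>i. f i + g i) = Abs_l2 f + Abs_l2 g"
    by (simp add: l2_fun_inject[symmetric] plus_l2.rep_eq l2_cut_Abs[OF *] l2_cut_Abs[OF assms(1)]
        l2_cut_Abs[OF assms(2)])
qed

lemma Abs_l2_scale:
  assumes "f \<in> ell2 I"
  shows "Abs_l2 (\<lambda>i. a * f i) = l2_scale a (Abs_l2 f)" "(\<lambda>i. a * f i) \<in> ell2 I"
proof -
  show *: "(\<lambda>i. a * f i) \<in> ell2 I"
    using assms ell2_cmult[of f a] by (simp add: ell2_iff[of _ I])
  show "Abs_l2 (\<lambda>i. a * f i) = l2_scale a (Abs_l2 f)"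
    by (simp add: l2_fun_inject[symmetric] l2_scale.rep_eq l2_cut_Abs[OF *] l2_cut_Abs[OF assms])
qed

lemma l2_restrict_bounded_ops:
  assumes F: "l2_operator I F"
  shows "l2_restrict I F \<in> bounded_ops I"
proof -
  note lin = bounded_linear.linear[OF l2_operatorD(1)[OF F]]
  obtain K where K: "\<And>v. norm (F v) \<le> norm v * K"
    using bounded_linear.bounded[OF l2_operatorD(1)[OF F]] by blast
  have "ell2_norm I (l2_restrict I F f) \<le> K * ell2_norm I f" if f: "f \<in> ell2 I" for f
    using K[of "Abs_l2 f"] l2_restrict_in_ell2[OF F f] f
    by (simp add: ell2_norm_UNIV l2_norm_eq l2_restrict_def l2_cut_Abs[OF f] mult.commute)
  moreover have "l2_restrict I F \<in> ell2 I \<rightarrow>\<^sub>E ell2 I"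
    using l2_restrict_in_ell2[OF F] by (auto simp: l2_restrict_def)
  ultimately show ?thesis
    unfolding bounded_ops_def
    by (auto simp: l2_restrict_def Abs_l2_add Abs_l2_scale linear_add[OF lin] l2_operatorD[OF F]
        plus_l2.rep_eq l2_scale.rep_eq)
qed

lemma bounded_opsD:
  assumes "T \<in> bounded_ops I"
  shows "f \<in> ell2 I \<Longrightarrow> T f \<in> ell2 I" "T \<in> ell2 I \<rightarrow>\<^sub>E ell2 I"
    "\<lbrakk>f \<in> ell2 I; g \<in> ell2 I\<rbrakk> \<Longrightarrow> T (\<lambda>i. f i + g i) = (\<lambda>i. T f i + T g i)"
    "f \<in> ell2 I \<Longrightarrow> T (\<lambda>i. a * f i) = (\<lambda>i. a * T f i)"
    "\<exists>K. \<forall>f\<in>ell2 I. ell2_norm I (T f) \<le> K * ell2_norm I f"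
  using assms by (auto simp: bounded_ops_def)

text \<open>Every bounded operator in the extensional encoding is the restriction of an
  \<open>l2_operator\<close>, so uniqueness in the descriptions of \<open>op_adj\<close> and
  \<open>op_abs\<close> can be tested on \<open>l2\<close>.\<close>

lemma l2_extend_operator:
  assumes T: "T \<in> bounded_ops I"
  shows "l2_operator I (l2_extend I T)" and "l2_restrict I (l2_extend I T) = T"
proof -
  note cut = l2_cut_in_ell2
  note TI = bounded_opsD(1)[OF T cut]
  have app: "l2_fun (l2_extend I T v) = T (l2_fun (l2_cut I v))" for v
    unfolding l2_extend_def by (rule l2_cut_Abs[OF TI])
  obtain K where K: "\<forall>f\<in>ell2 I. ell2_norm I (T f) \<le> K * ell2_norm I f"
    using bounded_opsD(5)[OF T] by blast
  have scale: "l2_extend I T (l2_scale a v) = l2_scale a (l2_extend I T v)" for a v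
    by (simp add: l2_fun_inject[symmetric] app l2_scale.rep_eq l2_comp_scale bounded_opsD(4)[OF T cut])
  have "bounded_linear (l2_extend I T)"
  proof (rule bounded_linear_intro[of _ "\<bar>K\<bar>"])
    have lin: "linear (l2_cut I)"
      by (intro bounded_linear.linear bounded_linear_l2_comp) simp
    show "l2_extend I T (v + w) = l2_extend I T v + l2_extend I T w" for v w
      by (simp add: l2_fun_inject[symmetric] app plus_l2.rep_eq linear_add[OF lin]
          bounded_opsD(3)[OF T cut cut])
    show "l2_extend I T (r *\<^sub>R v) = r *\<^sub>R l2_extend I T v" for r v
      using scale[of "of_real r" v] by (simp add: l2_scale_of_real)
    show "norm (l2_extend I T v) \<le> norm v * \<bar>K\<bar>" for v
    proof -
      have "norm (l2_extend I T v) = ell2_norm I (T (l2_fun (l2_cut I v)))"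
        by (simp add: l2_norm_eq app ell2_norm_UNIV[OF TI])
      also have "\<dots> \<le> K * norm (l2_cut I v)"
        using K cut[of I v] by (simp add: l2_norm_eq ell2_norm_UNIV[OF cut, symmetric])
      also have "\<dots> \<le> \<bar>K\<bar> * norm v"
      proof (rule mult_mono)
        have "(\<Sum>i\<in>F. (cmod (l2_fun (l2_cut I v) i))\<^sup>2) \<le> (norm v)\<^sup>2" if "finite F" for F
          using sum_l2_comp_le[of "\<lambda>i. i" I F v] that by (simp add: l2_fun_cut)
        then show "norm (l2_cut I v) \<le> norm v"
          by (intro l2_norm_leI) auto
      qed auto
      finally show ?thesis
        by (simp add: mult.commute)
    qed
  qed
  moreover have "l2_extend I T (l2_cut I v) = l2_extend I T v" for v
    by (simp add: l2_extend_def l2_fun_cut cong: if_cong)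
  moreover have "l2_cut I (l2_extend I T v) = l2_extend I T v" for v
    unfolding l2_extend_def by (rule l2_cut_Abs[OF TI])
  ultimately show "l2_operator I (l2_extend I T)"
    unfolding l2_operator_def using scale by blast
  show "l2_restrict I (l2_extend I T) = T"
  proof
    fix f
    show "l2_restrict I (l2_extend I T) f = T f"
      using bounded_opsD(2)[OF T]
      by (auto simp: l2_restrict_def app l2_cut_Abs PiE_def extensional_def)
  qed
qed

lemma ell2_inner_restrict:
  assumes F: "l2_operator I F" and fg: "f \<in> ell2 I" "g \<in> ell2 I"
  shows "ell2_inner I f (l2_restrict I F g) =
    Complex (inner (Abs_l2 f) (F (Abs_l2 g))) (inner (l2_scale \<i> (Abs_l2 f)) (F (Abs_l2 g)))"
    and "ell2_inner I (l2_restrict I F f) g =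
    Complex (inner (F (Abs_l2 f)) (Abs_l2 g)) (inner (F (l2_scale \<i> (Abs_l2 f))) (Abs_l2 g))"
  using ell2_inner_l2[of "Abs_l2 f" "F (Abs_l2 g)"] ell2_inner_l2[of "F (Abs_l2 f)" "Abs_l2 g"]
    l2_restrict_in_ell2[OF F fg(1)]
  by (simp_all add: ell2_inner_UNIV fg l2_restrict_def l2_cut_Abs[OF fg(1)] l2_cut_Abs[OF fg(2)]
      l2_operatorD(2)[OF F])

text \<open>Polarization, with \<open>J\<close> in the role of multiplication by the imaginary unit.\<close>

lemma symmetric_if_real_form:
  assumes S: "linear S" and J: "linear J" and JJ: "\<And>v. J (J v) = - v"
    and iso: "\<And>v w. inner (J v) (J w) = inner v w" and SJ: "\<And>v. S (J v) = J (S v)"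
    and re: "\<And>v. inner (J v) (S v) = 0"
  shows "inner (S v) w = inner v (S w)"
proof -
  have *: "inner (J v) (S w) + inner (J w) (S v) = 0" for v w
    using re[of "v + w"] by (simp add: linear_add[OF J] linear_add[OF S] inner_add_left inner_add_right re)
  have "inner (- v) (S w) + inner (J w) (J (S v)) = 0"
    using *[of "J v" w] by (simp add: JJ SJ)
  then show ?thesis
    by (simp add: iso inner_commute)
qed

text \<open>A nonnegative complex form is a nonnegative real form together with <i v, F v> = 0, and
  for complex-linear \<open>F\<close> the latter is equivalent to symmetry.\<close>

lemma positive_op_restrict:
  assumes F: "l2_operator I F"
  shows "positive_op I (l2_restrict I F) \<longleftrightarrow> positive_map F"
proof
  note lin = bounded_linear.linear[OF l2_operatorD(1)[OF F]]
  assume "positive_map F"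
  note R = positive_mapD[OF this]
  have "inner (l2_scale \<i> v) (F v) = 0" for v
  proof -
    have "inner (l2_scale \<i> v) (F v) = inner (F v) (l2_scale \<i> v)"
      by (rule inner_commute)
    also have "\<dots> = inner v (l2_scale \<i> (F v))"
      by (simp add: R(2) l2_operatorD[OF F])
    also have "\<dots> = - inner (l2_scale \<i> v) (F v)"
      using l2_scale_of_real[of "-1" "l2_scale \<i> (F v)"] by (simp add: inner_l2_scale l2_scale_scale)
    finally show ?thesis
      by simp
  qed
  then show "positive_op I (l2_restrict I F)"
    using R(3) by (auto simp: positive_op_def l2_restrict_bounded_ops[OF F] ell2_inner_restrict[OF F]
        complex_nonneg_Reals_iff)
next
  assume pos: "positive_op I (l2_restrict I F)"
  \<comment> \<open>The hypothesis speaks of vectors supported on \<open>I\<close> only; an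
    arbitrary \<open>v\<close> is reached through its cut, which \<open>F\<close> absorbs.\<close>
  have "ell2_inner I (l2_fun (l2_cut I v)) (l2_restrict I F (l2_fun (l2_cut I v))) \<in> \<real>\<^sub>\<ge>\<^sub>0" for v
    using pos l2_cut_in_ell2 by (auto simp: positive_op_def)
  then have cut: "inner (l2_cut I v) (F v) \<ge> 0 \<and> inner (l2_scale \<i> (l2_cut I v)) (F v) = 0" for v
    by (auto simp: ell2_inner_restrict[OF F] l2_cut_in_ell2 l2_fun_inverse complex_nonneg_Reals_iff
        l2_operatorD[OF F])
  have "inner (l2_cut I v) (F w) = inner v (F w)" for v w
    by (simp add: inner_l2_cut l2_operatorD[OF F])
  then have form: "inner v (F v) \<ge> 0" "inner (l2_scale \<i> v) (F v) = 0" for v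
    using cut[of v] by (simp_all flip: l2_comp_scale)
  have "inner (F v) w = inner v (F w)" for v w
  proof (rule symmetric_if_real_form[of F "l2_scale \<i>"])
    show "linear F" "linear (l2_scale \<i>)"
      by (auto intro!: bounded_linear.linear bounded_linear_l2_scale l2_operatorD(1)[OF F])
    show "l2_scale \<i> (l2_scale \<i> v) = - v" for v :: "'a l2"
      using l2_scale_of_real[of "-1" v] by (simp add: l2_scale_scale)
    show "inner (l2_scale \<i> v) (l2_scale \<i> w) = inner v w" for v w :: "'a l2"
      using l2_scale_of_real[of 1 w] by (simp add: inner_l2_scale l2_scale_scale)
  qed (simp_all add: l2_operatorD[OF F] form)
  then show "positive_map F"
    by (simp add: positive_map_def l2_operatorD[OF F] form)
qed

section \<open>Adjoints and absolute values of restricted operators\<close>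

lemma op_adj_restrict:
  assumes F: "l2_operator I F" and F': "l2_operator I F'"
    and adj: "\<And>v w. inner (F v) w = inner v (F' w)"
  shows "op_adj I (l2_restrict I F) = l2_restrict I F'"
  unfolding op_adj_def
proof (rule the_equality)
  show "l2_restrict I F' \<in> bounded_ops I \<and> (\<forall>f\<in>ell2 I. \<forall>g\<in>ell2 I.
      ell2_inner I (l2_restrict I F f) g = ell2_inner I f (l2_restrict I F' g))"
    by (auto simp: l2_restrict_bounded_ops F' ell2_inner_restrict F adj)
  fix S
  assume S: "S \<in> bounded_ops I \<and> (\<forall>f\<in>ell2 I. \<forall>g\<in>ell2 I.
      ell2_inner I (l2_restrict I F f) g = ell2_inner I f (S g))"
  define H where "H = l2_extend I S"
  have H: "l2_operator I H" and SH: "S = l2_restrict I H"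
    using S by (auto simp: H_def l2_extend_operator)
  have "H w = F' w" for w
  proof (rule l2_eqI_inner)
    fix u
    have "ell2_inner I (l2_restrict I F (l2_fun (l2_cut I u))) (l2_fun (l2_cut I w)) =
        ell2_inner I (l2_fun (l2_cut I u)) (S (l2_fun (l2_cut I w)))"
      using S l2_cut_in_ell2 by blast
    then have "inner (l2_cut I u) (H w) = inner (F u) (l2_cut I w)"
      by (simp add: SH ell2_inner_restrict[OF F] ell2_inner_restrict[OF H] l2_cut_in_ell2
          l2_fun_inverse l2_operatorD[OF F] l2_operatorD[OF H])
    then show "inner u (H w) = inner u (F' w)"
      by (simp add: inner_l2_cut adj l2_operatorD[OF H] l2_operatorD[OF F'])
  qed
  then show "S = l2_restrict I F'"
    by (simp add: SH fun_eq_iff l2_restrict_def)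
qed

lemma l2_restrict_restrict:
  assumes "l2_operator I H" "f \<in> ell2 I"
  shows "l2_restrict I F (l2_restrict I H f) = l2_fun (F (H (Abs_l2 f)))"
  using l2_restrict_in_ell2[OF assms] assms(2)
  by (simp add: l2_restrict_def l2_fun_inverse)

lemma l2_operator_op_sqrt:
  assumes R: "l2_operator I R" and pos: "positive_map R"
    and M: "M > 0" and le: "\<And>v. norm (R v) \<le> M * norm v"
  shows "l2_operator I (op_sqrt M R)"
proof -
  define S where "S = op_sqrt M R"
  note S = op_sqrt[OF pos M le, folded S_def]
  note lin = bounded_linear.linear[OF positive_mapD(1)[OF S(1)]]
  note linR = bounded_linear.linear[OF l2_operatorD(1)[OF R]]
  have comm: "Q (S v) = S (Q v)" if "bounded_linear Q" "\<And>v. Q (R v) = R (Q v)" for Q v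
    unfolding S_def by (rule op_sqrt_intertwine[OF pos pos M le le that])
  \<comment> \<open>Off \<open>I\<close>, where \<open>R\<close> vanishes, the root acts as sqrt M
    times 1 minus the sum of all coefficients, and for that sum only the upper bound 1 has been
    established. The identity ||S w||^2 = <w, R w> gives the vanishing directly.\<close>
  have "S (v - l2_cut I v) = 0" for v
  proof -
    have "inner (S (v - l2_cut I v)) (S (v - l2_cut I v)) = inner (v - l2_cut I v) (R (v - l2_cut I v))"
      by (simp add: positive_mapD(2)[OF S(1)] S(2))
    then show ?thesis
      by (simp add: linear_diff[OF linR] l2_operatorD[OF R])
  qed
  then have cut: "S (l2_cut I v) = S v" for v
    by (simp add: linear_diff[OF lin])
  moreover have "l2_cut I (S v) = S v" for v
    using comm[OF bounded_linear_l2_comp, of "\<lambda>i. i" I v] cut by (simp add: l2_operatorD[OF R])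
  moreover have "S (l2_scale a v) = l2_scale a (S v)" for a v
    using comm[OF bounded_linear_l2_scale, of a v] by (simp add: l2_operatorD[OF R])
  ultimately show ?thesis
    using positive_mapD(1)[OF S(1)] by (simp add: l2_operator_def S_def)
qed

lemma l2_operator_compose:
  assumes "l2_operator I F" "l2_operator I H"
  shows "l2_operator I (\<lambda>v. F (H v))"
  using assms by (simp add: l2_operator_def bounded_linear_compose)

text \<open>Existence comes from \<open>op_sqrt\<close>, uniqueness from
  \<open>op_sqrt_unique\<close> once a competing root has been extended to
  \<open>l2\<close>.\<close>

lemma op_abs_restrict:
  assumes F: "l2_operator I F" and F': "l2_operator I F'"
    and adj: "\<And>v w. inner (F v) w = inner v (F' w)"
    and M: "M > 0" and le: "\<And>v. norm (F' (F v)) \<le> M * norm v"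
  shows "op_abs I (l2_restrict I F) = l2_restrict I (op_sqrt M (\<lambda>v. F' (F v)))"
  unfolding op_abs_def op_adj_restrict[OF F F' adj]
proof (rule the_equality)
  define R where "R = (\<lambda>v. F' (F v))"
  have R: "positive_map R"
    unfolding R_def by (rule positive_map_adjoint_compose[OF l2_operatorD(1)[OF F] l2_operatorD(1)[OF F'] adj])
  have le: "norm (R v) \<le> M * norm v" for v
    unfolding R_def by (rule le)
  have opR: "l2_operator I R"
    unfolding R_def by (rule l2_operator_compose[OF F' F])
  note S = l2_operator_op_sqrt[OF opR R M le] op_sqrt[OF R M le]
  show "positive_op I (l2_restrict I (op_sqrt M (\<lambda>v. F' (F v)))) \<and> (\<forall>f\<in>ell2 I.
     l2_restrict I (op_sqrt M (\<lambda>v. F' (F v))) (l2_restrict I (op_sqrt M (\<lambda>v. F' (F v))) f) =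
     l2_restrict I F' (l2_restrict I F f))"
    using S by (simp add: R_def positive_op_restrict l2_restrict_restrict F)
  fix T
  assume T: "positive_op I T \<and> (\<forall>f\<in>ell2 I. T (T f) = l2_restrict I F' (l2_restrict I F f))"
  define H where "H = l2_extend I T"
  have H: "l2_operator I H" and TH: "T = l2_restrict I H"
    using T by (auto simp: H_def l2_extend_operator positive_op_def)
  have "positive_map H"
    using T by (simp add: TH positive_op_restrict[OF H])
  moreover have "H (H v) = R v" for v
  proof -
    have "T (T (l2_fun (l2_cut I v))) = l2_restrict I F' (l2_restrict I F (l2_fun (l2_cut I v)))"
      using T l2_cut_in_ell2 by blast
    then show ?thesis
      by (simp add: TH R_def l2_restrict_restrict H F l2_cut_in_ell2 l2_fun_inverse l2_fun_inject
          l2_operatorD(3)[OF F] l2_operatorD(3)[OF H])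
  qed
  ultimately have "H = op_sqrt M R"
    by (rule op_sqrt_unique[OF R M le])
  then show "T = l2_restrict I (op_sqrt M (\<lambda>v. F' (F v)))"
    by (simp add: TH R_def)
qed

text \<open>The vector e_i \<otimes> \<delta>_e is the basis vector at (i, e), so the trace is a
  finite sum of vector functionals.\<close>

lemma tr_vn_trace_restrict:
  fixes G :: "('a, 'b) monoid_scheme" and F :: "('n::finite \<times> 'a) l2 \<Rightarrow> ('n \<times> 'a) l2"
  assumes "group G"
  shows "Re (tr_vn_trace G (l2_restrict (UNIV \<times> carrier G) F)) =
    (\<Sum>i\<in>UNIV. inner (l2_delta (i, \<one>\<^bsub>G\<^esub>)) (F (l2_delta (i, \<one>\<^bsub>G\<^esub>))))"
proof -
  interpret group G by fact
  have "vn_trace G (op_block (carrier G) (l2_restrict (UNIV \<times> carrier G) F) i i) =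
      l2_fun (F (l2_delta (i, \<one>\<^bsub>G\<^esub>))) (i, \<one>\<^bsub>G\<^esub>)" for i :: 'n
  proof -
    have *: "(\<lambda>(l, k). if l = i then of_bool (k = \<one>\<^bsub>G\<^esub>) else 0) =
        (\<lambda>p. of_bool (p = (i, \<one>\<^bsub>G\<^esub>)) :: complex)"
      by (auto simp: fun_eq_iff)
    show ?thesis
      by (simp add: vn_trace_def delta_inner op_block_def delta_in_ell2 * l2_restrict_def l2_delta_def)
  qed
  then show ?thesis
    by (simp add: tr_vn_trace_def inner_l2_delta)
qed

section \<open>Matrix-valued convolution operators\<close>

text \<open>This is e_ij \<otimes> \<lambda>_g with e_ij a matrix unit.\<close>

definition shift_unit ::
  "('a, 'b) monoid_scheme \<Rightarrow> 'n \<Rightarrow> 'n \<Rightarrow> 'a \<Rightarrow> ('n \<times> 'a) l2 \<Rightarrow> ('n \<times> 'a) l2" where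
  "shift_unit G i j g = l2_comp ({i} \<times> carrier G) (\<lambda>(k, h). (j, inv\<^bsub>G\<^esub> g \<otimes>\<^bsub>G\<^esub> h))"

text \<open>The element \<Sum> C_k \<otimes> \<lambda>_{g_k}, split into matrix units so that every
  term is a multiple of an \<open>l2_comp\<close>; boundedness and the adjoint are then read off
  termwise.\<close>

definition conv_op ::
  "('a, 'b) monoid_scheme \<Rightarrow> 'k set \<Rightarrow> ('k \<Rightarrow> 'a) \<Rightarrow> ('k \<Rightarrow> complex^'n^'n) \<Rightarrow>
   ('n::finite \<times> 'a) l2 \<Rightarrow> ('n \<times> 'a) l2" where
  "conv_op G K g C v = (\<Sum>k\<in>K. \<Sum>i\<in>UNIV. \<Sum>j\<in>UNIV. l2_scale (C k $ i $ j) (shift_unit G i j (g k) v))"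

text \<open>These operators commute with every \<lambda>_g and move \<delta>_e to every other basis
  vector; the trace property rests on both facts.\<close>

definition right_translation ::
  "('a, 'b) monoid_scheme \<Rightarrow> 'a \<Rightarrow> ('n \<times> 'a) l2 \<Rightarrow> ('n \<times> 'a) l2" where
  "right_translation G t = l2_comp (UNIV \<times> carrier G) (\<lambda>(i, h). (i, h \<otimes>\<^bsub>G\<^esub> t))"

text \<open>The real part of $\mathrm{tr}\otimes\tau$, for operators on \<open>'n l2\<close>.\<close>

definition unit_trace :: "('a, 'b) monoid_scheme \<Rightarrow> (('n::finite \<times> 'a) l2 \<Rightarrow> ('n \<times> 'a) l2) \<Rightarrow> real" where
  "unit_trace G X = (\<Sum>i\<in>UNIV. inner (l2_delta (i, \<one>\<^bsub>G\<^esub>)) (X (l2_delta (i, \<one>\<^bsub>G\<^esub>))))"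

lemma l2_fun_sum: "l2_fun (sum f A) i = (\<Sum>a\<in>A. l2_fun (f a) i)"
  by (induction A rule: infinite_finite_induct) (simp_all add: zero_l2.rep_eq plus_l2.rep_eq)

context group
begin

lemma shift_unit_bij:
  assumes g: "g \<in> carrier G"
  shows "bij_betw (\<lambda>(k, h). (j, inv g \<otimes> h)) ({i} \<times> carrier G) ({j} \<times> carrier G)"
  by (rule bij_betw_byWitness[where f' = "\<lambda>(k, h). (i, g \<otimes> h)"])
     (use g in \<open>auto simp: m_assoc[symmetric]\<close>)

lemmas shift_unit_inj = bij_betw_imp_inj_on[OF shift_unit_bij]

lemma bounded_linear_shift_unit:
  "g \<in> carrier G \<Longrightarrow> bounded_linear (shift_unit G i j g)"
  unfolding shift_unit_def by (intro bounded_linear_l2_comp shift_unit_inj)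

lemma shift_unit_scale:
  "g \<in> carrier G \<Longrightarrow> shift_unit G i j g (l2_scale a v) = l2_scale a (shift_unit G i j g v)"
  unfolding shift_unit_def by (rule l2_comp_scale[OF shift_unit_inj])

lemma l2_fun_shift_unit:
  "g \<in> carrier G \<Longrightarrow> l2_fun (shift_unit G i j g v) (k, h) =
     (if k = i \<and> h \<in> carrier G then l2_fun v (j, inv g \<otimes> h) else 0)"
  unfolding shift_unit_def by (subst l2_fun_comp[OF shift_unit_inj]) auto

lemma inner_shift_unit:
  assumes "g \<in> carrier G"
  shows "inner (shift_unit G i j g v) w = inner v (shift_unit G j i (inv g) w)"
  unfolding shift_unit_def
  by (rule inner_l2_comp[OF shift_unit_bij[OF assms]]) (use assms in \<open>auto simp: m_assoc[symmetric]\<close>)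

lemma shift_unit_delta:
  assumes "g \<in> carrier G" "t \<in> carrier G"
  shows "shift_unit G i j g (l2_delta (l, t)) = (if l = j then l2_delta (i, g \<otimes> t) else 0)"
proof -
  have "inv g \<otimes> h = t \<longleftrightarrow> h = g \<otimes> t" if "h \<in> carrier G" for h
    using assms that by (metis inv_closed inv_inv m_assoc l_inv l_one r_inv)
  then show ?thesis
    using assms by (auto simp: l2_fun_inject[symmetric] fun_eq_iff l2_fun_shift_unit l2_delta.rep_eq zero_l2.rep_eq)
qed

lemma l2_fun_conv_op:
  assumes "\<And>k. k \<in> K \<Longrightarrow> g k \<in> carrier G"
  shows "l2_fun (conv_op G K g C v) (i, h) = (if h \<in> carrier G
    then \<Sum>k\<in>K. \<Sum>j\<in>UNIV. C k $ i $ j * l2_fun v (j, inv g k \<otimes> h) else 0)"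
proof -
  have "(\<Sum>i'\<in>UNIV. \<Sum>j\<in>UNIV. l2_fun (l2_scale (C k $ i' $ j) (shift_unit G i' j (g k) v)) (i, h)) =
     (if h \<in> carrier G then \<Sum>j\<in>UNIV. C k $ i $ j * l2_fun v (j, inv g k \<otimes> h) else 0)" if "k \<in> K" for k
  proof -
    have "(\<Sum>j\<in>UNIV. l2_fun (l2_scale (C k $ i' $ j) (shift_unit G i' j (g k) v)) (i, h)) =
        (if i' = i then if h \<in> carrier G then \<Sum>j\<in>UNIV. C k $ i $ j * l2_fun v (j, inv g k \<otimes> h) else 0 else 0)" for i'
      using assms[OF that] by (auto simp: l2_scale.rep_eq l2_fun_shift_unit)
    then show ?thesis
      by simp
  qed
  then show ?thesis
    by (simp add: conv_op_def l2_fun_sum)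
qed

lemma conv_op_operator:
  assumes "\<And>k. k \<in> K \<Longrightarrow> g k \<in> carrier G"
  shows "l2_operator (UNIV \<times> carrier G) (conv_op G K g C)"
proof -
  have "bounded_linear (conv_op G K g C)"
    unfolding conv_op_def[abs_def]
    by (intro bounded_linear_sum bounded_linear_compose[OF bounded_linear_l2_scale]
        bounded_linear_shift_unit assms)
  then show ?thesis
    using assms
    by (auto simp: l2_operator_def l2_fun_inject[symmetric] fun_eq_iff l2_fun_conv_op l2_fun_cut
        l2_scale.rep_eq sum_distrib_left mult_ac intro!: sum.cong)
qed

lemma inner_conv_op:
  assumes "\<And>k. k \<in> K \<Longrightarrow> g k \<in> carrier G"
  shows "inner (conv_op G K g C v) w = inner v (conv_op G K (\<lambda>k. inv g k) (\<lambda>k. mat_adj (C k)) w)"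
proof -
  have "inner (conv_op G K g C v) w =
      (\<Sum>k\<in>K. \<Sum>i\<in>UNIV. \<Sum>j\<in>UNIV. inner (shift_unit G i j (g k) v) (l2_scale (cnj (C k $ i $ j)) w))"
    by (simp add: conv_op_def inner_sum_left inner_l2_scale)
  also have "\<dots> = (\<Sum>k\<in>K. \<Sum>i\<in>UNIV. \<Sum>j\<in>UNIV.
      inner v (l2_scale (cnj (C k $ i $ j)) (shift_unit G j i (inv g k) w)))"
    using assms by (auto intro!: sum.cong simp: inner_shift_unit shift_unit_scale)
  also have "\<dots> = (\<Sum>k\<in>K. \<Sum>j\<in>UNIV. \<Sum>i\<in>UNIV.
      inner v (l2_scale (cnj (C k $ i $ j)) (shift_unit G j i (inv g k) w)))"
    by (intro sum.cong refl sum.swap)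
  finally show ?thesis
    by (simp add: conv_op_def inner_sum_right mat_adj_def)
qed

lemma conv_op_delta:
  assumes "\<And>k. k \<in> K \<Longrightarrow> g k \<in> carrier G" "t \<in> carrier G"
  shows "conv_op G K g C (l2_delta (l, t)) =
    (\<Sum>k\<in>K. \<Sum>i\<in>UNIV. l2_scale (C k $ i $ l) (l2_delta (i, g k \<otimes> t)))"
proof -
  have "(\<Sum>j\<in>UNIV. l2_scale (C k $ i $ j) (shift_unit G i j (g k) (l2_delta (l, t)))) =
      (\<Sum>j\<in>UNIV. if j = l then l2_scale (C k $ i $ l) (l2_delta (i, g k \<otimes> t)) else 0)" if "k \<in> K" for k i
    using assms that by (intro sum.cong) (auto simp: shift_unit_delta linear_0[OF bounded_linear.linear[OF bounded_linear_l2_scale]])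
  then show ?thesis
    unfolding conv_op_def by (intro sum.cong refl) simp
qed

lemma op_sum_mat_tensor_eq_conv_op:
  fixes C :: "'k \<Rightarrow> complex^'n::finite^'n"
  assumes "\<And>k. k \<in> K \<Longrightarrow> g k \<in> carrier G"
  shows "op_sum (UNIV \<times> carrier G) K (\<lambda>k. mat_tensor (carrier G) (C k) (left_reg G (g k))) =
    l2_restrict (UNIV \<times> carrier G) (conv_op G K g C)"
proof -
  \<comment> \<open>\<open>left_reg\<close> is \<open>undefined\<close> off \<open>ell2\<close>, so
    its formula applies to the slices of \<open>f\<close> only once they are known to be
    square-summable.\<close>
  have slice: "(\<lambda>k. f (j, k)) \<in> ell2 (carrier G)" if f: "f \<in> ell2 (UNIV \<times> carrier G)" 
    for f :: "'n \<times> 'a \<Rightarrow> complex" and j :: 'n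
  proof -
    have f': "l2_fun (Abs_l2 f) = f"
      by (rule l2_cut_Abs(2)[OF f])
    have "l2_fun (l2_comp (carrier G) (\<lambda>k. (j, k)) (Abs_l2 f)) = (\<lambda>k. f (j, k))"
      using f by (subst l2_fun_comp) (auto simp: inj_on_def f' ell2_def)
    then have "(\<lambda>k. f (j, k)) \<in> ell2 UNIV"
      by (metis l2_fun)
    then show ?thesis
      using f by (subst ell2_iff) (auto simp: ell2_def)
  qed
  show ?thesis
    unfolding op_sum_def l2_restrict_def
  proof (intro restrict_ext ext, clarify)
    fix f :: "'n \<times> 'a \<Rightarrow> complex" and i h
    assume f: "f \<in> ell2 (UNIV \<times> carrier G)"
    show "(\<Sum>k\<in>K. mat_tensor (carrier G) (C k) (left_reg G (g k)) f (i, h)) =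
        l2_fun (conv_op G K g C (Abs_l2 f)) (i, h)"
      using f by (simp add: l2_fun_conv_op assms mat_tensor_def left_reg_def slice l2_cut_Abs(2)[OF f])
  qed
qed

section \<open>Right translations and the trace property\<close>

lemma right_translation_bij:
  assumes t: "t \<in> carrier G"
  shows "bij_betw (\<lambda>(i, h). (i, h \<otimes> t)) (UNIV \<times> carrier G) (UNIV \<times> carrier G)"
  by (rule bij_betw_byWitness[where f' = "\<lambda>(i, h). (i, h \<otimes> inv t)"])
     (use t in \<open>auto simp: m_assoc\<close>)

lemmas right_translation_inj = bij_betw_imp_inj_on[OF right_translation_bij]

lemma right_translation_scale:
  "t \<in> carrier G \<Longrightarrow> right_translation G t (l2_scale a v) = l2_scale a (right_translation G t v)"
  unfolding right_translation_def by (rule l2_comp_scale[OF right_translation_inj])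

lemma l2_fun_right_translation:
  "t \<in> carrier G \<Longrightarrow> l2_fun (right_translation G t v) (i, h) =
     (if h \<in> carrier G then l2_fun v (i, h \<otimes> t) else 0)"
  unfolding right_translation_def by (subst l2_fun_comp[OF right_translation_inj]) auto

lemma inner_right_translation:
  assumes "t \<in> carrier G"
  shows "inner (right_translation G t v) w = inner v (right_translation G (inv t) w)"
  unfolding right_translation_def
  by (rule inner_l2_comp[OF right_translation_bij[OF assms]]) (use assms in \<open>auto simp: m_assoc\<close>)

lemma right_translation_delta:
  assumes "t \<in> carrier G"
  shows "right_translation G t (l2_delta (i, \<one>)) = l2_delta (i, inv t)"
proof -
  have "h \<otimes> t = \<one> \<longleftrightarrow> h = inv t" if "h \<in> carrier G" for h
    using assms that inv_equality[of h t] by auto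
  then show ?thesis
    using assms
    by (auto simp: l2_fun_inject[symmetric] fun_eq_iff l2_fun_right_translation l2_delta.rep_eq)
qed

lemma right_translation_conv_op:
  assumes "\<And>k. k \<in> K \<Longrightarrow> g k \<in> carrier G" "t \<in> carrier G"
  shows "conv_op G K g C (right_translation G t v) = right_translation G t (conv_op G K g C v)"
  using assms by (auto simp: l2_fun_inject[symmetric] fun_eq_iff l2_fun_conv_op
      l2_fun_right_translation m_assoc intro!: sum.cong)

text \<open>Traciality, with \<open>Y\<close> taken from the commutant of the right translations, so
  that powers of operators are covered. Such a \<open>Y\<close> is determined by its values at the
  identity: its value at \<delta>_h is a translate of that at \<delta>_e. Moved to the other side of
  the inner product, the translation sends \<delta>_e to the basis vector at \<open>inv h\<close>,
  which is where the adjoint convolution operator puts it.\<close>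

lemma unit_trace_commute:
  fixes Y :: "('n::finite \<times> 'a) l2 \<Rightarrow> ('n \<times> 'a) l2"
  assumes g: "\<And>k. k \<in> K \<Longrightarrow> g k \<in> carrier G"
    and Y: "linear Y" and scale: "\<And>a v. Y (l2_scale a v) = l2_scale a (Y v)"
    and trans: "\<And>t v. t \<in> carrier G \<Longrightarrow> Y (right_translation G t v) = right_translation G t (Y v)"
  shows "unit_trace G (\<lambda>v. Y (conv_op G K g C v)) = unit_trace G (\<lambda>v. conv_op G K g C (Y v))"
proof -
  define d where "d = (\<lambda>i t. l2_delta (i, t) :: ('n \<times> 'a) l2)"
  note g' = inv_closed[OF g]
  have adj: "inner (conv_op G K (\<lambda>k. inv g k) (\<lambda>k. mat_adj (C k)) v) w = inner v (conv_op G K g C w)"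
    for v w
    using inner_conv_op[where g = g and C = C and v = w and w = v, OF g] by (simp add: inner_commute)
  have rt: "inner (d j \<one>) (l2_scale a (Y (d i h))) = inner (d j (inv h)) (l2_scale a (Y (d i \<one>)))"
    if h: "h \<in> carrier G" for a i j h
  proof -
    have "Y (d i h) = right_translation G (inv h) (Y (d i \<one>))"
      using trans[of "inv h" "d i \<one>"] h by (simp add: d_def right_translation_delta)
    then have "l2_scale a (Y (d i h)) = right_translation G (inv h) (l2_scale a (Y (d i \<one>)))"
      using h by (simp add: right_translation_scale)
    then have "inner (l2_scale a (Y (d i h))) (d j \<one>) =
        inner (l2_scale a (Y (d i \<one>))) (right_translation G h (d j \<one>))"
      using h by (simp add: inner_right_translation)
    then show ?thesis
      using h by (simp add: d_def right_translation_delta inner_commute)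
  qed
  have "unit_trace G (\<lambda>v. Y (conv_op G K g C v)) =
      (\<Sum>j\<in>UNIV. \<Sum>k\<in>K. \<Sum>i\<in>UNIV. inner (d j \<one>) (l2_scale (C k $ i $ j) (Y (d i (g k)))))"
    by (simp add: unit_trace_def conv_op_delta g linear_sum[OF Y] scale inner_sum_right d_def)
  also have "\<dots> = (\<Sum>j\<in>UNIV. \<Sum>k\<in>K. \<Sum>i\<in>UNIV. inner (d j (inv g k)) (l2_scale (C k $ i $ j) (Y (d i \<one>))))"
    by (intro sum.cong refl rt g)
  also have "\<dots> = (\<Sum>j\<in>UNIV. \<Sum>i\<in>UNIV. \<Sum>k\<in>K. inner (d j (inv g k)) (l2_scale (C k $ i $ j) (Y (d i \<one>))))"
    by (rule sum.cong[OF refl], rule sum.swap)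
  also have "\<dots> = (\<Sum>i\<in>UNIV. \<Sum>j\<in>UNIV. \<Sum>k\<in>K. inner (d j (inv g k)) (l2_scale (C k $ i $ j) (Y (d i \<one>))))"
    by (rule sum.swap)
  also have "\<dots> = (\<Sum>i\<in>UNIV. \<Sum>k\<in>K. \<Sum>j\<in>UNIV. inner (d j (inv g k)) (l2_scale (C k $ i $ j) (Y (d i \<one>))))"
    by (rule sum.cong[OF refl], rule sum.swap)
  also have "\<dots> = (\<Sum>i\<in>UNIV. inner (conv_op G K (\<lambda>k. inv g k) (\<lambda>k. mat_adj (C k)) (d i \<one>)) (Y (d i \<one>)))"
    unfolding d_def
    by (simp add: conv_op_delta g' inner_sum_left mat_adj_def inner_l2_scale)
  also have "\<dots> = (\<Sum>i\<in>UNIV. inner (d i \<one>) (conv_op G K g C (Y (d i \<one>))))"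
    by (simp only: adj)
  finally show ?thesis
    by (simp add: unit_trace_def d_def)
qed

text \<open>Vector functionals are continuous, so the trace may be applied termwise to the series;
  only traces of powers remain.\<close>

lemma unit_trace_op_sqrt:
  fixes R :: "('n::finite \<times> 'a) l2 \<Rightarrow> ('n \<times> 'a) l2"
  assumes "\<And>v. norm (v - (1 / M) *\<^sub>R R v) \<le> norm v"
  shows "unit_trace G (op_sqrt M R) = sqrt M * (unit_trace G (\<lambda>v :: ('n \<times> 'a) l2. v)
    - (\<Sum>n. sqrt_coeff n * unit_trace G ((\<lambda>v. v - (1 / M) *\<^sub>R R v) ^^ n)))"
proof -
  define K where "K = (\<lambda>v. v - (1 / M) *\<^sub>R R v)"
  have sm: "summable (\<lambda>n. sqrt_coeff n *\<^sub>R (K ^^ n) v)" for v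
    by (rule summable_sqrt_series) (simp add: K_def assms)
  have *: "inner d (sqrt_series K d) = (\<Sum>n. sqrt_coeff n * inner d ((K ^^ n) d))"
    "summable (\<lambda>n. sqrt_coeff n * inner d ((K ^^ n) d))" for d
    using bounded_linear.suminf[OF bounded_linear_inner_right sm, of d d]
      bounded_linear.summable[OF bounded_linear_inner_right sm, of d d]
    by (simp_all add: sqrt_series_def)
  show ?thesis
    unfolding unit_trace_def op_sqrt_def K_def[symmetric]
    by (simp add: inner_diff_right sum_subtractf sum_distrib_left right_diff_distrib *
        suminf_sum[OF *(2)])
qed

text \<open>Both roots are expanded with the same \<open>M\<close>, so it is enough to compare the
  traces of the powers of A = 1 - F^*F/M and B = 1 - FF^*/M. These agree by induction: F A^n = B^n
  F, and traciality carries F^* to the other end.\<close>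

lemma unit_trace_sqrt_adjoint:
  fixes C :: "'k \<Rightarrow> complex^'n::finite^'n"
  assumes g: "\<And>k. k \<in> K \<Longrightarrow> g k \<in> carrier G" and M: "M > 0"
  defines "F \<equiv> conv_op G K g C" and "F' \<equiv> conv_op G K (\<lambda>k. inv g k) (\<lambda>k. mat_adj (C k))"
  assumes le: "\<And>v. norm (F' (F v)) \<le> M * norm v" "\<And>v. norm (F (F' v)) \<le> M * norm v"
  shows "unit_trace G (op_sqrt M (\<lambda>v. F' (F v))) = unit_trace G (op_sqrt M (\<lambda>v. F (F' v)))"
proof -
  define A where "A = (\<lambda>v. v - (1 / M) *\<^sub>R F' (F v))"
  define B where "B = (\<lambda>v. v - (1 / M) *\<^sub>R F (F' v))"
  note opF = conv_op_operator[of K g C, OF g, folded F_def]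
  note opF' = conv_op_operator[of K "\<lambda>k. inv g k" "\<lambda>k. mat_adj (C k)", OF inv_closed[OF g], folded F'_def]
  have adj: "inner (F v) w = inner v (F' w)" for v w
    unfolding F_def F'_def by (rule inner_conv_op[OF g])
  have adj': "inner (F' v) w = inner v (F w)" for v w
    by (metis adj inner_commute)
  have pos: "positive_map (\<lambda>v. F' (F v))" "positive_map (\<lambda>v. F (F' v))"
    using positive_map_adjoint_compose l2_operatorD(1) opF opF' adj adj' by blast+
  note linF = bounded_linear.linear[OF l2_operatorD(1)[OF opF]]
  note linF' = bounded_linear.linear[OF l2_operatorD(1)[OF opF']]
  have bB: "bounded_linear B"
    unfolding B_def by (intro bounded_linear_one_minus bounded_linear_compose[OF l2_operatorD(1)[OF opF] l2_operatorD(1)[OF opF']])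
  have FA: "F ((A ^^ n) v) = (B ^^ n) (F v)" for n v
    by (induction n) (simp_all add: A_def B_def linear_diff[OF linF] linear_cmul[OF linF])
  have rt: "F (right_translation G t v) = right_translation G t (F v)"
    "F' (right_translation G t v) = right_translation G t (F' v)" if "t \<in> carrier G" for t v
    unfolding F_def F'_def using g that by (auto intro!: right_translation_conv_op)
  \<comment> \<open>These commutations make \<open>\<lambda>v. (B ^^ n) (F v)\<close> an admissible
    \<open>Y\<close> in \<open>unit_trace_commute\<close>.\<close>
  have Bn: "(B ^^ n) (l2_scale a v) = l2_scale a ((B ^^ n) v)"
    "t \<in> carrier G \<Longrightarrow> (B ^^ n) (right_translation G t v) = right_translation G t ((B ^^ n) v)" for n a t v
  proof -
    have *: "(B ^^ n) (Q v) = Q ((B ^^ n) v)"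
      if Q: "linear Q" "\<And>w. F (Q w) = Q (F w)" "\<And>w. F' (Q w) = Q (F' w)" for Q
    proof -
      have "B (Q w) = Q (B w)" for w
        by (simp add: B_def Q linear_diff[OF Q(1)] linear_cmul[OF Q(1)])
      then show ?thesis
        by (induction n) simp_all
    qed
    show "(B ^^ n) (l2_scale a v) = l2_scale a ((B ^^ n) v)"
      by (rule *) (auto intro!: bounded_linear.linear bounded_linear_l2_scale l2_operatorD(2)[OF opF] l2_operatorD(2)[OF opF'])
    show "(B ^^ n) (right_translation G t v) = right_translation G t ((B ^^ n) v)" if t: "t \<in> carrier G"
    proof (rule *)
      show "linear (right_translation G t :: ('n \<times> 'a) l2 \<Rightarrow> _)"
        unfolding right_translation_def
        by (intro bounded_linear.linear bounded_linear_l2_comp right_translation_inj t)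
    qed (rule rt[OF t])+
  qed
  have "unit_trace G (A ^^ n) = unit_trace G (B ^^ n)" for n
  proof (induction n)
    case (Suc n)
    have A: "unit_trace G (A ^^ Suc n) = unit_trace G (A ^^ n) - 1 / M * unit_trace G (\<lambda>v. F' (F ((A ^^ n) v)))"
      by (simp add: unit_trace_def A_def[THEN fun_cong] inner_diff_right sum_subtractf sum_distrib_left)
    have "unit_trace G (\<lambda>v. F' (F ((A ^^ n) v))) = unit_trace G (\<lambda>v. F' ((B ^^ n) (F v)))"
      by (simp add: FA)
    also have "\<dots> = unit_trace G (\<lambda>v. (B ^^ n) (F (F' v)))"
      unfolding F'_def
    proof (rule unit_trace_commute[symmetric])
      show "linear (\<lambda>v. (B ^^ n) (F v))"
        by (intro bounded_linear.linear bounded_linear_compose[OF bounded_linear_funpow[OF bB] l2_operatorD(1)[OF opF]])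
    qed (use g rt Bn l2_operatorD(2)[OF opF] in auto)
    finally have FA': "unit_trace G (\<lambda>v. F' (F ((A ^^ n) v))) = unit_trace G (\<lambda>v. (B ^^ n) (F (F' v)))" .
    note linB = bounded_linear.linear[OF bounded_linear_funpow[OF bB, of n]]
    have "(B ^^ n) (B v) = (B ^^ n) v - (1 / M) *\<^sub>R (B ^^ n) (F (F' v))" for v
      unfolding B_def[THEN fun_cong, of v] linear_diff[OF linB] linear_cmul[OF linB] ..
    then have "unit_trace G (B ^^ n) - 1 / M * unit_trace G (\<lambda>v. (B ^^ n) (F (F' v))) =
        unit_trace G (\<lambda>v. (B ^^ n) (B v))"
      by (simp add: unit_trace_def inner_diff_right sum_subtractf sum_distrib_left)
    also have "\<dots> = unit_trace G (B ^^ Suc n)"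
      by (simp add: unit_trace_def funpow_swap1)
    finally show ?case
      unfolding A FA' Suc .
  qed simp
  then show ?thesis
    using unit_trace_op_sqrt[OF positive_map_contraction[OF pos(1) M le(1)]]
      unit_trace_op_sqrt[OF positive_map_contraction[OF pos(2) M le(2)]]
    by (simp add: A_def B_def)
qed

end

section \<open>Matrices and the norm of $S_1^2(\ell_2)$\<close>

lemma bounded_linear_matrix_vector: "bounded_linear ((*v) (A :: complex^'n^'m))"
proof -
  have "linear ((*v) A)"
    by (intro linearI)
       (simp_all add: vec_eq_iff matrix_vector_mult_def scaleR_sum_right distrib_left sum.distrib)
  then show ?thesis
    by (simp add: linear_conv_bounded_linear)
qed

lemma inner_vec_complex: "inner (v :: complex^'n) w = Re (\<Sum>i\<in>UNIV. cnj (v $ i) * w $ i)"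
  by (simp add: inner_vec_def inner_complex_def)

lemma mat_adj_adj [simp]: "mat_adj (mat_adj A) = A"
  by (simp add: mat_adj_def vec_eq_iff)

lemma inner_mat_adj: "inner (A *v v) w = inner v (mat_adj A *v w)"
proof -
  have "(\<Sum>i\<in>UNIV. cnj ((A *v v) $ i) * w $ i) = (\<Sum>i\<in>UNIV. \<Sum>j\<in>UNIV. cnj (A $ i $ j) * cnj (v $ j) * w $ i)"
    by (simp add: matrix_vector_mult_def sum_distrib_right)
  also have "\<dots> = (\<Sum>j\<in>UNIV. \<Sum>i\<in>UNIV. cnj (A $ i $ j) * cnj (v $ j) * w $ i)"
    by (rule sum.swap)
  also have "\<dots> = (\<Sum>j\<in>UNIV. cnj (v $ j) * (mat_adj A *v w) $ j)"
    by (simp add: matrix_vector_mult_def mat_adj_def sum_distrib_left mult_ac)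
  finally show ?thesis
    by (simp add: inner_vec_complex)
qed

text \<open>The equivalence of \<open>positive_op_restrict\<close> again, now for the complex
  structure \<open>J\<close> on C^n.\<close>

lemma mat_psd_iff: "mat_psd A \<longleftrightarrow> positive_map ((*v) A)"
proof -
  define J where "J = (\<lambda>v :: complex^'a. \<i> *s v)"
  have lin: "linear ((*v) A)"
    by (rule bounded_linear.linear[OF bounded_linear_matrix_vector])
  have J: "linear J"
    by (rule linearI) (simp_all add: J_def vec_eq_iff algebra_simps scaleR_conv_of_real[where 'a=complex])
  have JJ: "J (J v) = - v" for v
    by (simp add: J_def vec_eq_iff)
  have iso: "inner (J v) (J w) = inner v w" for v w
    by (simp add: J_def inner_vec_complex)
  have AJ: "A *v J v = J (A *v v)" for v
    by (simp add: J_def vector_scalar_commute)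
  have form: "(\<Sum>i\<in>UNIV. cnj (v $ i) * (A *v v) $ i) = Complex (inner v (A *v v)) (inner (J v) (A *v v))" for v
    by (simp add: complex_eq_iff inner_vec_complex J_def sum_subtractf)
  have skew: "inner (J v) (A *v v) = 0" if "\<And>v w. inner (A *v v) w = inner v (A *v w)" for v
  proof -
    have "inner (J v) (A *v v) = inner (A *v J v) v"
      by (simp add: that)
    also have "\<dots> = inner (J (J (A *v v))) (J v)"
      by (simp add: AJ iso)
    finally show ?thesis
      by (simp add: JJ inner_commute)
  qed
  have "mat_psd A \<longleftrightarrow> (\<forall>v. inner v (A *v v) \<ge> 0 \<and> inner (J v) (A *v v) = 0)"
    unfolding mat_psd_def form by (auto simp: complex_nonneg_Reals_iff)
  also have "\<dots> \<longleftrightarrow> positive_map ((*v) A)"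
    using symmetric_if_real_form[OF lin J JJ iso AJ] skew
    unfolding positive_map_def by (auto simp: bounded_linear_matrix_vector)
  finally show ?thesis .
qed

lemma mat_sqrt:
  assumes "mat_psd A"
  shows "mat_psd (mat_sqrt A)" "mat_sqrt A ** mat_sqrt A = A"
proof -
  have A: "positive_map ((*v) A)"
    using assms by (simp add: mat_psd_iff)
  obtain K where K: "\<And>v. norm (A *v v) \<le> norm v * K"
    using bounded_linear.bounded[OF bounded_linear_matrix_vector] by blast
  define M where "M = \<bar>K\<bar> + 1"
  have M: "M > 0"
    by (simp add: M_def)
  have le: "norm (A *v v) \<le> M * norm v" for v
  proof -
    have "norm v * K \<le> norm v * M"
      by (intro mult_left_mono) (auto simp: M_def)
    then show ?thesis
      using K[of v] by (simp add: mult.commute)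
  qed
  define S where "S = op_sqrt M ((*v) A)"
  note S = op_sqrt[OF A M le, folded S_def]
  \<comment> \<open>A priori the root is only real-linear; intertwining with multiplication by
    \<open>c\<close> makes it complex-linear, hence a matrix.\<close>
  have "S (c *s v) = c *s S v" for c v
  proof -
    have "linear ((*s) c :: complex^'a \<Rightarrow> _)"
      by (rule linearI) (simp_all add: vec_eq_iff algebra_simps scaleR_conv_of_real[where 'a=complex])
    then have "bounded_linear ((*s) c :: complex^'a \<Rightarrow> _)"
      by (simp add: linear_conv_bounded_linear)
    from op_sqrt_intertwine[OF A A M le le this] show ?thesis
      unfolding S_def by (simp add: vector_scalar_commute)
  qed
  moreover have "S (v + w) = S v + S w" for v w
    by (rule linear_add[OF bounded_linear.linear[OF positive_mapD(1)[OF S(1)]]])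
  ultimately have "Vector_Spaces.linear (*s) (*s) S"
    by (intro Vector_Spaces.linear_iff[THEN iffD2]) (auto simp: vec.vector_space_axioms)
  then have SB: "matrix S *v v = S v" for v
    by (rule matrix_works)
  have "mat_psd (mat_sqrt A) \<and> mat_sqrt A ** mat_sqrt A = A"
    unfolding mat_sqrt_def
  proof (rule theI[of _ "matrix S"])
    have "(*v) (matrix S) = S"
      by (simp add: fun_eq_iff SB)
    then show "mat_psd (matrix S) \<and> matrix S ** matrix S = A"
      using S by (simp add: mat_psd_iff matrix_eq SB matrix_vector_mul_assoc[symmetric])
    fix R assume R: "mat_psd R \<and> R ** R = A"
    then have "R *v (R *v v) = A *v v" for v
      by (simp add: matrix_vector_mul_assoc)
    then have "(*v) R = S"
      unfolding S_def using R by (intro op_sqrt_unique[OF A M le]) (auto simp: mat_psd_iff)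
    then show "R = matrix S"
      by (simp add: matrix_eq SB)
  qed
  then show "mat_psd (mat_sqrt A)" "mat_sqrt A ** mat_sqrt A = A"
    by auto
qed

lemma matrix_vector_mult_sum: "(\<Sum>k\<in>K. A k) *v v = (\<Sum>k\<in>K. A k *v v)"
  by (induction K rule: infinite_finite_induct) (simp_all add: matrix_vector_mult_add_rdistrib)

lemma inner_sum_mat_adj_mult:
  "inner v ((\<Sum>k\<in>K. mat_adj (X k) ** X k) *v v) = (\<Sum>k\<in>K. (norm (X k *v v))\<^sup>2)"
  by (simp add: matrix_vector_mult_sum inner_sum_right power2_norm_eq_inner inner_mat_adj
      matrix_vector_mul_assoc)

lemma mat_psd_sum_adj_mult: "mat_psd (\<Sum>k\<in>K. mat_adj (X k) ** X k)"
proof -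
  have "inner ((\<Sum>k\<in>K. mat_adj (X k) ** X k) *v v) w = inner v ((\<Sum>k\<in>K. mat_adj (X k) ** X k) *v w)" for v w
    by (simp add: matrix_vector_mult_sum inner_sum_right inner_sum_left inner_mat_adj
        matrix_vector_mul_assoc[symmetric])
  then show ?thesis
    by (simp add: mat_psd_iff positive_map_def bounded_linear_matrix_vector inner_sum_mat_adj_mult sum_nonneg)
qed

section \<open>Unitary bases of C^2 and duality\<close>

definition unitary_col :: "complex \<Rightarrow> complex \<Rightarrow> complex^2" where
  "unitary_col a b = (\<chi> i. if i = 1 then a else b)"

lemma unitary_col_nth [simp]: "unitary_col a b $ 1 = a" "unitary_col a b $ 2 = b"
  by (simp_all add: unitary_col_def)

text \<open>The two vectors are the columns of a matrix in SU(2), hence an orthonormal basis; in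
  dimension 2 the invariance of the trace is a single expansion.\<close>

lemma Re_trace_unitary_basis:
  assumes "cnj a * a + cnj b * b = 1"
  shows "Re (trace M) = inner (unitary_col a b) (M *v unitary_col a b) +
    inner (unitary_col (- cnj b) (cnj a)) (M *v unitary_col (- cnj b) (cnj a))"
proof -
  have "trace M = (cnj a * a + cnj b * b) * (M $ 1 $ 1 + M $ 2 $ 2)"
    using assms by (simp add: trace_def sum_2)
  also have "\<dots> = cnj a * (M $ 1 $ 1 * a + M $ 1 $ 2 * b) + cnj b * (M $ 2 $ 1 * a + M $ 2 $ 2 * b) +
     (cnj (- cnj b) * (M $ 1 $ 1 * (- cnj b) + M $ 1 $ 2 * cnj a) +
      cnj (cnj a) * (M $ 2 $ 1 * (- cnj b) + M $ 2 $ 2 * cnj a))"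
    by (simp add: algebra_simps)
  finally show ?thesis
    by (simp add: inner_vec_complex matrix_vector_mult_def sum_2)
qed

lemma hermitian_eigenbasis_2:
  fixes R :: "complex^2^2"
  assumes "mat_adj R = R"
  obtains a b r s where "cnj a * a + cnj b * b = 1"
    "R *v unitary_col a b = r *\<^sub>R unitary_col a b"
    "R *v unitary_col (- cnj b) (cnj a) = s *\<^sub>R unitary_col (- cnj b) (cnj a)"
proof -
  define p q z where "p = Re (R $ 1 $ 1)" "q = Re (R $ 2 $ 2)" "z = R $ 1 $ 2"
  have h: "cnj (R $ j $ i) = R $ i $ j" for i j
    using arg_cong[OF assms, of "\<lambda>M. M $ i $ j"] by (simp add: mat_adj_def)
  have R: "R $ 1 $ 1 = complex_of_real p" "R $ 2 $ 2 = complex_of_real q" "R $ 1 $ 2 = z" "R $ 2 $ 1 = cnj z"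
    using arg_cong[OF h[of 1 1], of Im] arg_cong[OF h[of 2 2], of Im] h[of 1 2]
    by (simp_all add: p_q_z_def complex_eq_iff)
  show ?thesis
  proof (cases "z = 0")
    case True
    show ?thesis
      by (rule that[of 1 0 p q])
         (simp_all add: vec_eq_iff forall_2 matrix_vector_mult_def sum_2 R True scaleR_conv_of_real[where 'a=complex])
  next
    case False
    \<comment> \<open>The larger root of the characteristic polynomial. The vector (z, l - p)
      satisfies the first row of the eigenvalue equation by construction; the second row is
      \<open>yz\<close>. The other eigenvalue p + q - l comes from the trace.\<close>
    define l where "l = ((p + q) + sqrt ((p - q)\<^sup>2 + 4 * (cmod z)\<^sup>2)) / 2"
    define y where "y = l - p"
    have "(sqrt ((p - q)\<^sup>2 + 4 * (cmod z)\<^sup>2))\<^sup>2 = (p - q)\<^sup>2 + 4 * (cmod z)\<^sup>2"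
      by (intro real_sqrt_pow2) auto
    moreover have "sqrt ((p - q)\<^sup>2 + 4 * (cmod z)\<^sup>2) = 2 * l - p - q"
      by (simp add: l_def field_simps)
    ultimately have "(2 * l - p - q)\<^sup>2 = (p - q)\<^sup>2 + 4 * (cmod z)\<^sup>2"
      by simp
    then have yz: "y * (l - q) = (cmod z)\<^sup>2"
      by (simp add: y_def power2_eq_square algebra_simps)
    have l: "complex_of_real l = of_real p + of_real y"
      by (simp add: y_def)
    have zc: "cnj z * z = of_real ((cmod z)\<^sup>2)"
      by (simp add: complex_norm_square mult.commute del: of_real_power)
    then have zz: "cnj z * z = of_real y * (of_real p + of_real y - of_real q)"
      by (simp add: yz[symmetric] l)
    define w where "w = complex_of_real (1 / sqrt ((cmod z)\<^sup>2 + y\<^sup>2))"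
    have [simp]: "cnj w = w"
      by (simp add: w_def)
    have "w * w * (of_real ((cmod z)\<^sup>2 + y\<^sup>2)) = 1"
    proof -
      have "(cmod z)\<^sup>2 + y\<^sup>2 > 0"
        using False by (simp add: add_pos_nonneg)
      then show ?thesis
        unfolding w_def using False by (simp flip: of_real_mult of_real_add of_real_power)
    qed
    then have w: "w * w * (cnj z * z + of_real y * of_real y) = 1"
      unfolding zc by (simp add: power2_eq_square)
    show ?thesis
    proof (rule that[of "w * z" "w * of_real y" l "p + q - l"])
      show "cnj (w * z) * (w * z) + cnj (w * of_real y) * (w * of_real y) = 1"
        using w by (simp add: algebra_simps)
      have e: "cnj z * (w * z) = w * (of_real y * (of_real p + of_real y - of_real q))"
        by (simp add: zz[symmetric])
      show "R *v unitary_col (w * z) (w * of_real y) = l *\<^sub>R unitary_col (w * z) (w * of_real y)"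
        by (simp add: vec_eq_iff forall_2 matrix_vector_mult_def sum_2 R scaleR_conv_of_real[where 'a=complex] e l)
           (simp add: algebra_simps)
      have e': "z * (w * cnj z) = w * (of_real y * (of_real p + of_real y - of_real q))"
        by (simp add: zz[symmetric])
      show "R *v unitary_col (- cnj (w * of_real y)) (cnj (w * z)) =
          (p + q - l) *\<^sub>R unitary_col (- cnj (w * of_real y)) (cnj (w * z))"
        by (simp add: vec_eq_iff forall_2 matrix_vector_mult_def sum_2 R scaleR_conv_of_real[where 'a=complex] e' l)
           (simp add: algebra_simps)
    qed
  qed
qed

text \<open>Duality between \<open>X\<close> in the trace class column space and the multiple \<open>C\<close> of a column isometry:
  evaluate the trace in an eigenbasis of $(\sum_kX_k^*X_k)^{1/2}$.\<close>

lemma Re_trace_le_mat_sqrt: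
  fixes C X :: "'k \<Rightarrow> complex^2^2"
  assumes C: "(\<Sum>k\<in>K. mat_adj (C k) ** C k) = mat (complex_of_real (c\<^sup>2))" and c: "c \<ge> 0"
  shows "Re (trace (\<Sum>k\<in>K. mat_adj (C k) ** X k)) \<le>
    c * Re (trace (mat_sqrt (\<Sum>k\<in>K. mat_adj (X k) ** X k)))"
proof -
  define R where "R = mat_sqrt (\<Sum>k\<in>K. mat_adj (X k) ** X k)"
  have R: "positive_map ((*v) R)" and RR: "R ** R = (\<Sum>k\<in>K. mat_adj (X k) ** X k)"
    unfolding R_def using mat_sqrt[OF mat_psd_sum_adj_mult] by (auto simp: mat_psd_iff)
  have "mat_adj R = R"
  proof (unfold matrix_eq, rule allI)
    fix w
    have "inner v (mat_adj R *v w) = inner v (R *v w)" for v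
      by (simp add: inner_mat_adj[symmetric] positive_mapD(2)[OF R])
    then show "mat_adj R *v w = R *v w"
      using vector_eq_ldot[of "mat_adj R *v w" "R *v w"] by blast
  qed
  then obtain a b r s where ab: "cnj a * a + cnj b * b = 1"
    and eig: "R *v unitary_col a b = r *\<^sub>R unitary_col a b"
      "R *v unitary_col (- cnj b) (cnj a) = s *\<^sub>R unitary_col (- cnj b) (cnj a)"
    by (rule hermitian_eigenbasis_2)
  define u u' where "u = unitary_col a b" "u' = unitary_col (- cnj b) (cnj a)"
  have u: "inner u u = 1" "inner u' u' = 1"
    using arg_cong[OF ab, of Re] by (simp_all add: u_u'_def inner_vec_complex sum_2)
  \<comment> \<open>For a unit eigenvector, \<Sum> ||X_k w||^2 = ||R w||^2 = t^2 with t = <w, R w>,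
    and \<Sum> ||C_k w||^2 = c^2, so Cauchy-Schwarz over \<open>K\<close> gives c t. At a general
    vector ||R w|| may exceed <w, R w>; hence the eigenbasis.\<close>
  have bound: "(\<Sum>k\<in>K. inner (C k *v w) (X k *v w)) \<le> c * inner w (R *v w)"
    if w: "inner w w = 1" and Rw: "R *v w = t *\<^sub>R w" for w t
  proof -
    have t: "inner w (R *v w) = t" "t \<ge> 0"
      using positive_mapD(3)[OF R, of w] w Rw by simp_all
    have "inner w ((\<Sum>k\<in>K. mat_adj (X k) ** X k) *v w) = inner (R *v w) (R *v w)"
      by (simp add: RR[symmetric] matrix_vector_mul_assoc[symmetric] positive_mapD(2)[OF R])
    then have X: "(\<Sum>k\<in>K. (norm (X k *v w))\<^sup>2) = t\<^sup>2"
      by (simp add: inner_sum_mat_adj_mult Rw w power2_eq_square)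
    have "(\<Sum>k\<in>K. (norm (C k *v w))\<^sup>2) = inner w (mat (complex_of_real (c\<^sup>2)) *v w)"
      by (simp add: inner_sum_mat_adj_mult[symmetric] C)
    also have "mat (complex_of_real (c\<^sup>2)) *v w = c\<^sup>2 *\<^sub>R w"
      by (simp add: vec_eq_iff matrix_vector_mult_def mat_def scaleR_conv_of_real[where 'a=complex] if_distrib[of "\<lambda>x. x * _"] cong: if_cong)
    finally have C': "(\<Sum>k\<in>K. (norm (C k *v w))\<^sup>2) = c\<^sup>2"
      by (simp add: w)
    have "(\<Sum>k\<in>K. inner (C k *v w) (X k *v w)) \<le> (\<Sum>k\<in>K. \<bar>norm (C k *v w)\<bar> * \<bar>norm (X k *v w)\<bar>)"
      by (intro sum_mono) (simp add: norm_cauchy_schwarz)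
    also have "\<dots> \<le> L2_set (\<lambda>k. norm (C k *v w)) K * L2_set (\<lambda>k. norm (X k *v w)) K"
      by (rule L2_set_mult_ineq)
    also have "\<dots> = c * t"
      using c t(2) by (simp add: L2_set_def C' X)
    finally show ?thesis
      by (simp add: t)
  qed
  have "Re (trace (\<Sum>k\<in>K. mat_adj (C k) ** X k)) =
      (\<Sum>k\<in>K. inner (C k *v u) (X k *v u)) + (\<Sum>k\<in>K. inner (C k *v u') (X k *v u'))"
    unfolding Re_trace_unitary_basis[OF ab] u_u'_def[symmetric]
    by (simp add: matrix_vector_mult_sum inner_sum_right inner_mat_adj matrix_vector_mul_assoc[symmetric])
  also have "\<dots> \<le> c * inner u (R *v u) + c * inner u' (R *v u')"
    using bound[OF u(1), of r] bound[OF u(2), of s] eig by (simp add: u_u'_def)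
  also have "\<dots> = c * Re (trace R)"
    unfolding Re_trace_unitary_basis[OF ab] u_u'_def by (simp add: distrib_left)
  finally show ?thesis
    by (simp add: R_def)
qed

lemma Re_trace_adj_mult: "Re (trace (mat_adj A ** B)) = Re (trace (A ** mat_adj B))"
proof -
  have "trace (mat_adj A ** B) = trace (B ** mat_adj A)"
    by (rule trace_mul_sym)
  also have "\<dots> = cnj (trace (A ** mat_adj B))"
    by (simp add: trace_def matrix_matrix_mult_def mat_adj_def mult.commute)
  finally show ?thesis
    by simp
qed

lemma trace_sum: "trace (\<Sum>k\<in>K. A k) = (\<Sum>k\<in>K. trace (A k))"
  by (induction K rule: infinite_finite_induct) (simp_all add: trace_def sum.distrib)

text \<open>Pairing C = X + Y with C itself gives 2 c^2 = Re tr \<Sum> C^* X + Re tr \<Sum> C^* Y,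
  the 2 being the dimension. The column estimate bounds the first term by c times the column norm of
  X and, after adjunction, the second by c times the row norm of Y.\<close>

lemma S1_ell2_norm_ge:
  fixes C :: "'k \<Rightarrow> complex^2^2"
  assumes C: "(\<Sum>k\<in>K. mat_adj (C k) ** C k) = mat (complex_of_real (c\<^sup>2))"
    "(\<Sum>k\<in>K. C k ** mat_adj (C k)) = mat (complex_of_real (c\<^sup>2))" and c: "c > 0"
  shows "2 * c \<le> S1_ell2_norm K C"
  unfolding S1_ell2_norm_def
proof (rule cInf_greatest)
  have "\<exists>X Y. \<forall>k\<in>K. C k = X k + Y k"
    by (rule exI[of _ C], rule exI[of _ "\<lambda>_. 0"]) simp
  then show "{Re (trace (mat_sqrt (\<Sum>k\<in>K. mat_adj (X k) ** X k))) +
      Re (trace (mat_sqrt (\<Sum>k\<in>K. Y k ** mat_adj (Y k)))) | X Y. \<forall>k\<in>K. C k = X k + Y k} \<noteq> {}"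
    by blast
  fix x
  assume "x \<in> {Re (trace (mat_sqrt (\<Sum>k\<in>K. mat_adj (X k) ** X k))) +
      Re (trace (mat_sqrt (\<Sum>k\<in>K. Y k ** mat_adj (Y k)))) | X Y. \<forall>k\<in>K. C k = X k + Y k}"
  then obtain X Y where x: "x = Re (trace (mat_sqrt (\<Sum>k\<in>K. mat_adj (X k) ** X k))) +
      Re (trace (mat_sqrt (\<Sum>k\<in>K. Y k ** mat_adj (Y k))))" and XY: "\<forall>k\<in>K. C k = X k + Y k"
    by blast
  have "2 * c\<^sup>2 = Re (trace (\<Sum>k\<in>K. mat_adj (C k) ** C k))"
    by (simp add: C trace_def mat_def sum_2)
  also have "\<dots> = Re (trace (\<Sum>k\<in>K. mat_adj (C k) ** X k)) + Re (trace (\<Sum>k\<in>K. mat_adj (C k) ** Y k))"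
    using XY unfolding trace_sum Re_sum sum.distrib[symmetric]
    by (intro sum.cong refl) (simp flip: trace_add matrix_add_ldistrib plus_complex.sel)
  also have "Re (trace (\<Sum>k\<in>K. mat_adj (C k) ** Y k)) =
      Re (trace (\<Sum>k\<in>K. mat_adj (mat_adj (C k)) ** mat_adj (Y k)))"
    by (simp add: trace_sum Re_trace_adj_mult)
  also have "Re (trace (\<Sum>k\<in>K. mat_adj (C k) ** X k)) + \<dots> \<le>
      c * Re (trace (mat_sqrt (\<Sum>k\<in>K. mat_adj (X k) ** X k))) +
      c * Re (trace (mat_sqrt (\<Sum>k\<in>K. mat_adj (mat_adj (Y k)) ** mat_adj (Y k))))"
    using C c by (intro add_mono Re_trace_le_mat_sqrt) auto
  finally have "c * (2 * c) \<le> c * x"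
    by (simp add: x distrib_left power2_eq_square)
  then show "2 * c \<le> x"
    using c by simp
qed

text \<open>Adjunction exchanges the column part \<open>X\<close> with the row part
  \<open>Y\<close>, so both infima run over the same set.\<close>

lemma S1_ell2_norm_adj: "S1_ell2_norm K (\<lambda>k. mat_adj (C k)) = S1_ell2_norm K C"
proof -
  define V where "V = (\<lambda>C. {Re (trace (mat_sqrt (\<Sum>k\<in>K. mat_adj (X k) ** X k))) +
      Re (trace (mat_sqrt (\<Sum>k\<in>K. Y k ** mat_adj (Y k)))) | X Y.
      \<forall>k\<in>K. C k = X k + (Y k :: complex^'b^'b)})"
  have "V C \<subseteq> V (\<lambda>k. mat_adj (C k))" for C
  proof
    fix x assume "x \<in> V C"
    then obtain X Y where x: "x = Re (trace (mat_sqrt (\<Sum>k\<in>K. mat_adj (X k) ** X k))) +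
        Re (trace (mat_sqrt (\<Sum>k\<in>K. Y k ** mat_adj (Y k))))" and XY: "\<forall>k\<in>K. C k = X k + Y k"
      unfolding V_def by blast
    have "\<forall>k\<in>K. mat_adj (C k) = mat_adj (Y k) + mat_adj (X k)"
      using XY by (simp add: mat_adj_def vec_eq_iff)
    moreover have "x = Re (trace (mat_sqrt (\<Sum>k\<in>K. mat_adj (mat_adj (Y k)) ** mat_adj (Y k)))) +
        Re (trace (mat_sqrt (\<Sum>k\<in>K. mat_adj (X k) ** mat_adj (mat_adj (X k)))))"
      by (simp add: x)
    ultimately show "x \<in> V (\<lambda>k. mat_adj (C k))"
      unfolding V_def mem_Collect_eq
      by (intro exI[of _ "\<lambda>k. mat_adj (Y k)"] exI[of _ "\<lambda>k. mat_adj (X k)"] conjI)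
  qed
  from this[of C] this[of "\<lambda>k. mat_adj (C k)"] have "V (\<lambda>k. mat_adj (C k)) = V C"
    by auto
  then show ?thesis
    by (simp add: S1_ell2_norm_def V_def)
qed

section \<open>Consequences of the Khintchine type inequality\<close>

text \<open>The hypothesis of the theorem as a predicate of \<open>V\<close>, so that it can be
  transferred to the set of inverses.\<close>

definition khintchine_sqrt2 :: "('a, 'b) monoid_scheme \<Rightarrow> 'a set \<Rightarrow> bool" where
  "khintchine_sqrt2 G V \<longleftrightarrow> (\<forall>(r::nat) (g :: nat \<Rightarrow> 'a) (C :: nat \<Rightarrow> complex^2^2).
     1 \<le> r \<longrightarrow> r \<le> 6 \<longrightarrow> (\<forall>m\<in>{1..r}. g m \<in> V) \<longrightarrow> inj_on g {1..r} \<longrightarrow>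
     S1_ell2_norm {1..r} C \<le> sqrt 2 * Re (tr_vn_trace G (op_abs (UNIV \<times> carrier G)
       (op_sum (UNIV \<times> carrier G) {1..r} (\<lambda>m. mat_tensor (carrier G) (C m) (left_reg G (g m)))))))"

lemma l2_scale_simps [simp]: "l2_scale 1 v = v" "l2_scale 0 v = 0" "l2_scale (a + b) v = l2_scale a v + l2_scale b v"
  by (transfer; simp add: distrib_right)+

text \<open>One \<open>M\<close> for F^*F and FF^* alike, as the comparison of their roots
  requires.\<close>

lemma (in group) conv_op_bound:
  fixes C :: "'k \<Rightarrow> complex^'n::finite^'n"
  assumes "\<And>k. k \<in> K \<Longrightarrow> g k \<in> carrier G"
  defines "F \<equiv> conv_op G K g C" and "F' \<equiv> conv_op G K (\<lambda>k. inv g k) (\<lambda>k. mat_adj (C k))"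
  obtains M where "M > 0" "\<And>v. norm (F' (F v)) \<le> M * norm v" "\<And>v. norm (F (F' v)) \<le> M * norm v"
proof -
  have F: "bounded_linear F" "bounded_linear F'"
    unfolding F_def F'_def
    by (rule l2_operatorD(1)[OF conv_op_operator]; simp add: assms(1))+
  obtain K1 where K1: "\<And>v. norm (F' (F v)) \<le> norm v * K1"
    using bounded_linear.bounded[OF bounded_linear_compose[OF F(2,1)]] by blast
  obtain K2 where K2: "\<And>v. norm (F (F' v)) \<le> norm v * K2"
    using bounded_linear.bounded[OF bounded_linear_compose[OF F(1,2)]] by blast
  define M where "M = max 1 (max K1 K2)"
  have "norm v * K1 \<le> M * norm v" "norm v * K2 \<le> M * norm v" for v :: "('n \<times> 'a) l2"
    unfolding mult.commute[of "norm v"] by (intro mult_right_mono; simp add: M_def)+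
  then show ?thesis
    using order_trans[OF K1] order_trans[OF K2] by (intro that[of M]) (simp_all add: M_def)
qed

lemma (in group) tr_vn_trace_abs:
  fixes C :: "'k \<Rightarrow> complex^'n::finite^'n"
  assumes g: "\<And>k. k \<in> K \<Longrightarrow> g k \<in> carrier G"
  defines "F \<equiv> conv_op G K g C" and "F' \<equiv> conv_op G K (\<lambda>k. inv g k) (\<lambda>k. mat_adj (C k))"
  assumes M: "M > 0" "\<And>v. norm (F' (F v)) \<le> M * norm v"
  shows "Re (tr_vn_trace G (op_abs (UNIV \<times> carrier G)
    (op_sum (UNIV \<times> carrier G) K (\<lambda>k. mat_tensor (carrier G) (C k) (left_reg G (g k)))))) =
    unit_trace G (op_sqrt M (\<lambda>v. F' (F v)))"
proof -
  have "op_abs (UNIV \<times> carrier G) (l2_restrict (UNIV \<times> carrier G) F) =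
      l2_restrict (UNIV \<times> carrier G) (op_sqrt M (\<lambda>v. F' (F v)))"
  proof (rule op_abs_restrict)
    show "l2_operator (UNIV \<times> carrier G) F" "l2_operator (UNIV \<times> carrier G) F'"
      unfolding F_def F'_def by (intro conv_op_operator inv_closed g; assumption)+
    show "inner (F v) w = inner v (F' w)" for v w
      unfolding F_def F'_def by (rule inner_conv_op[OF g])
  qed (use M in auto)
  then show ?thesis
    using tr_vn_trace_restrict[OF is_group] op_sum_mat_tensor_eq_conv_op[where g = g and K = K and C = C, OF g]
    by (simp add: unit_trace_def F_def)
qed

lemma (in group) khintchine_sqrt2_inv:
  assumes "khintchine_sqrt2 G V" "V \<subseteq> carrier G"
  shows "khintchine_sqrt2 G ((\<lambda>x. inv x) ` V)"
  unfolding khintchine_sqrt2_def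
proof (intro allI impI)
  fix r :: nat and g :: "nat \<Rightarrow> 'a" and C :: "nat \<Rightarrow> complex^2^2"
  assume r: "1 \<le> r" "r \<le> 6" and gV: "\<forall>m\<in>{1..r}. g m \<in> (\<lambda>x. inv x) ` V" and inj: "inj_on g {1..r}"
  have gV': "inv (g m) \<in> V" "g m \<in> carrier G" if m: "m \<in> {1..r}" for m
  proof -
    obtain x where "x \<in> V" "g m = inv x"
      using bspec[OF gV m] by blast
    then show "inv (g m) \<in> V" "g m \<in> carrier G"
      using subsetD[OF assms(2), of x] by simp_all
  qed
  define D where "D = (\<lambda>m. mat_adj (C m))"
  define h where "h = (\<lambda>m. inv (g m))"
  have h: "h m \<in> carrier G" if "m \<in> {1..r}" for m
    using gV'(2)[OF that] by (simp add: h_def)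
  obtain M where M: "M > 0"
    "\<And>v. norm (conv_op G {1..r} (\<lambda>k. inv h k) (\<lambda>k. mat_adj (D k)) (conv_op G {1..r} h D v)) \<le> M * norm v"
    "\<And>v. norm (conv_op G {1..r} h D (conv_op G {1..r} (\<lambda>k. inv h k) (\<lambda>k. mat_adj (D k)) v)) \<le> M * norm v"
    by (rule conv_op_bound[where K = "{1..r}" and g = h and C = D, OF h], assumption, rule that)
  \<comment> \<open>\<open>D\<close> and \<open>h\<close> describe f^*; inversion and
    \<open>mat_adj\<close> are involutions, so the adjoint of f^* is f again.\<close>
  have FD: "conv_op G {1..r} (\<lambda>k. inv h k) (\<lambda>k. mat_adj (D k)) = conv_op G {1..r} g C"
    unfolding conv_op_def[abs_def] h_def D_def
    by (rule ext, rule sum.cong) (simp_all add: gV'(2) del: atLeastAtMost_iff)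
  have "S1_ell2_norm {1..r} C = S1_ell2_norm {1..r} D"
    unfolding D_def S1_ell2_norm_adj ..
  moreover have "S1_ell2_norm {1..r} D \<le> sqrt 2 * Re (tr_vn_trace G (op_abs (UNIV \<times> carrier G)
       (op_sum (UNIV \<times> carrier G) {1..r} (\<lambda>m. mat_tensor (carrier G) (D m) (left_reg G (h m))))))"
  proof -
    have "inj_on h {1..r}"
    proof (rule inj_onI)
      fix a b assume ab: "a \<in> {1..r}" "b \<in> {1..r}" "h a = h b"
      from ab(3) have "inv (h a) = inv (h b)"
        by (rule arg_cong)
      then have "g a = g b"
        unfolding h_def inv_inv[OF gV'(2)[OF ab(1)]] inv_inv[OF gV'(2)[OF ab(2)]] .
      then show "a = b"
        using inj_onD[OF inj] ab by blast
    qed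
    moreover have "\<forall>m\<in>{1..r}. h m \<in> V"
      using gV'(1) by (simp add: h_def)
    ultimately show ?thesis
      using assms(1)[unfolded khintchine_sqrt2_def, THEN spec, THEN spec, THEN spec, of r h D] r
      by iprover
  qed
  moreover have "Re (tr_vn_trace G (op_abs (UNIV \<times> carrier G)
       (op_sum (UNIV \<times> carrier G) {1..r} (\<lambda>m. mat_tensor (carrier G) (D m) (left_reg G (h m)))))) =
     unit_trace G (op_sqrt M (\<lambda>v. conv_op G {1..r} g C (conv_op G {1..r} h D v)))"
    unfolding FD[symmetric]
    by (rule tr_vn_trace_abs[where K = "{1..r}" and g = h and M = M and C = D, OF h M(1,2)])
  moreover have "Re (tr_vn_trace G (op_abs (UNIV \<times> carrier G)
       (op_sum (UNIV \<times> carrier G) {1..r} (\<lambda>m. mat_tensor (carrier G) (C m) (left_reg G (g m)))))) =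
     unit_trace G (op_sqrt M (\<lambda>v. conv_op G {1..r} h D (conv_op G {1..r} g C v)))"
    unfolding h_def D_def
    by (rule tr_vn_trace_abs[where K = "{1..r}" and g = g and M = M and C = C, OF gV'(2) M(1)
          M(3)[unfolded FD, unfolded h_def D_def]])
  moreover have "unit_trace G (op_sqrt M (\<lambda>v. conv_op G {1..r} g C (conv_op G {1..r} h D v))) =
      unit_trace G (op_sqrt M (\<lambda>v. conv_op G {1..r} h D (conv_op G {1..r} g C v)))"
    unfolding FD[symmetric]
    by (rule unit_trace_sqrt_adjoint[where K = "{1..r}" and g = h and M = M and C = D, OF h M])
  ultimately show "S1_ell2_norm {1..r} C \<le> sqrt 2 * Re (tr_vn_trace G (op_abs (UNIV \<times> carrier G)
       (op_sum (UNIV \<times> carrier G) {1..r} (\<lambda>m. mat_tensor (carrier G) (C m) (left_reg G (g m))))))"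
    by (simp only:)
qed

text \<open>Duality bounds the coefficient norm below by 2 c, and \<open>sum_inner_abs_le\<close>
  bounds tr|f| above; both are used after multiplication by 2 t. Coefficients are indexed by the
  group elements in \<open>W\<close> and enumerated only inside the proof. All that is asked of
  \<open>p i\<close> is that \<open>F\<close> cannot tell it from the basis vector.\<close>

lemma (in group)
  fixes C :: "'a \<Rightarrow> complex^2^2" and p :: "2 \<Rightarrow> (2 \<times> 'a) l2"
  assumes V: "khintchine_sqrt2 G V" "V \<subseteq> carrier G"
    and W: "W \<subseteq> V" "finite W" "W \<noteq> {}" "card W \<le> 6"
    and C: "(\<Sum>v\<in>W. mat_adj (C v) ** C v) = mat (complex_of_real (c\<^sup>2))"
      "(\<Sum>v\<in>W. C v ** mat_adj (C v)) = mat (complex_of_real (c\<^sup>2))" and c: "c > 0"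
  defines "F \<equiv> conv_op G W (\<lambda>v. v) C"
  assumes p: "\<And>i. F (p i) = F (l2_delta (i, \<one>))" and t: "t > 0"
  shows khintchine_sqrt2_le: "4 * c * t \<le>
      sqrt 2 * ((\<Sum>i\<in>UNIV. (norm (F (l2_delta (i, \<one>))))\<^sup>2) + t\<^sup>2 * (\<Sum>i\<in>UNIV. (norm (p i))\<^sup>2))"
    and khintchine_sqrt2_less: "inner (F w) (F (l2_delta (i, \<one>))) \<noteq> t\<^sup>2 * inner w (p i) \<Longrightarrow> 4 * c * t <
      sqrt 2 * ((\<Sum>i\<in>UNIV. (norm (F (l2_delta (i, \<one>))))\<^sup>2) + t\<^sup>2 * (\<Sum>i\<in>UNIV. (norm (p i))\<^sup>2))"
proof -
  define F' where "F' = conv_op G W (\<lambda>v. inv v) (\<lambda>v. mat_adj (C v))"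
  have WG: "v \<in> carrier G" if "v \<in> W" for v
    using that W V by auto
  define r where "r = card W"
  obtain h where h: "bij_betw h {1..r} W"
    using finite_same_card_bij[of "{1..r}" W] W(2) by (auto simp: r_def)
  have hW: "h m \<in> W" if "m \<in> {1..r}" for m
    using h that by (auto simp: bij_betw_def)
  have hG: "h m \<in> carrier G" if "m \<in> {1..r}" for m
    using WG hW that by blast
  have F: "conv_op G {1..r} h (\<lambda>m. C (h m)) = F"
    unfolding F_def conv_op_def[abs_def]
    by (rule ext, rule sum.reindex_bij_betw[OF h])
  have F': "conv_op G {1..r} (\<lambda>m. inv h m) (\<lambda>m. mat_adj (C (h m))) = F'"
    unfolding F'_def conv_op_def[abs_def]
    by (rule ext, rule sum.reindex_bij_betw[OF h])
  have op: "l2_operator (UNIV \<times> carrier G) F" "l2_operator (UNIV \<times> carrier G) F'"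
    unfolding F_def F'_def by (intro conv_op_operator inv_closed WG; assumption)+
  have adj: "inner (F v) w = inner v (F' w)" for v w
    unfolding F_def F'_def by (rule inner_conv_op[OF WG])
  obtain M where M: "M > 0" "\<And>v. norm (F' (F v)) \<le> M * norm v"
    using conv_op_bound[of W "\<lambda>v. v", OF WG] unfolding F_def F'_def by metis
  define T where "T = unit_trace G (op_sqrt M (\<lambda>v. F' (F v)))"
  have "2 * c \<le> S1_ell2_norm {1..r} (\<lambda>m. C (h m))"
    by (rule S1_ell2_norm_ge[OF trans[OF sum.reindex_bij_betw[OF h] C(1)] trans[OF sum.reindex_bij_betw[OF h] C(2)] c])
  also have "\<dots> \<le> sqrt 2 * Re (tr_vn_trace G (op_abs (UNIV \<times> carrier G)
       (op_sum (UNIV \<times> carrier G) {1..r} (\<lambda>m. mat_tensor (carrier G) (C (h m)) (left_reg G (h m))))))"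
  proof -
    have "1 \<le> r" "r \<le> 6"
      using W by (auto simp: r_def Suc_le_eq card_gt_0_iff)
    moreover have "\<forall>m\<in>{1..r}. h m \<in> V"
      using hW W(1) by blast
    moreover have "inj_on h {1..r}"
      using h by (auto simp: bij_betw_def)
    ultimately show ?thesis
      using V(1) unfolding khintchine_sqrt2_def by blast
  qed
  also have "\<dots> = sqrt 2 * T"
    using tr_vn_trace_abs[where K = "{1..r}" and g = h and M = M and C = "\<lambda>m. C (h m)", OF hG, unfolded F F', OF _ M]
    by (simp add: T_def)
  finally have cT: "2 * c \<le> sqrt 2 * T" .
  have ct: "4 * c * t \<le> sqrt 2 * (2 * t * T)"
    using mult_left_mono[OF cT, of "2 * t"] t by (simp add: mult_ac)
  note pos = positive_map_adjoint_compose[OF l2_operatorD(1)[OF op(1)] l2_operatorD(1)[OF op(2)] adj]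
  note S = op_sqrt[OF pos M]
  have "2 * t * T \<le> (\<Sum>i\<in>UNIV. (norm (F (l2_delta (i, \<one>))))\<^sup>2) + t\<^sup>2 * (\<Sum>i\<in>UNIV. (norm (p i))\<^sup>2)"
    unfolding T_def unit_trace_def
    by (rule sum_inner_abs_le[OF S l2_operatorD(1)[OF op(1)] adj p t])
  then show "4 * c * t \<le> sqrt 2 * ((\<Sum>i\<in>UNIV. (norm (F (l2_delta (i, \<one>))))\<^sup>2) + t\<^sup>2 * (\<Sum>i\<in>UNIV. (norm (p i))\<^sup>2))"
    by (intro order_trans[OF ct] mult_left_mono) auto
  \<comment> \<open>Pairing with one vector \<open>w\<close> suffices to rule out F^*F d_i = t^2
    p_i, the equality case.\<close>
  assume "inner (F w) (F (l2_delta (i, \<one>))) \<noteq> t\<^sup>2 * inner w (p i)"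
  then have "F' (F (l2_delta (i, \<one>))) \<noteq> t\<^sup>2 *\<^sub>R p i"
    by (auto simp: adj)
  then have "\<exists>i\<in>UNIV. F' (F (l2_delta (i, \<one>))) \<noteq> t\<^sup>2 *\<^sub>R p i"
    by blast
  then have "2 * t * T < (\<Sum>i\<in>UNIV. (norm (F (l2_delta (i, \<one>))))\<^sup>2) + t\<^sup>2 * (\<Sum>i\<in>UNIV. (norm (p i))\<^sup>2)"
    unfolding T_def unit_trace_def
    by (intro sum_inner_abs_less[OF S l2_operatorD(1)[OF op(1)] adj p t]) auto
  then show "4 * c * t < sqrt 2 * ((\<Sum>i\<in>UNIV. (norm (F (l2_delta (i, \<one>))))\<^sup>2) + t\<^sup>2 * (\<Sum>i\<in>UNIV. (norm (p i))\<^sup>2))"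
    by (intro le_less_trans[OF ct] mult_strict_left_mono) auto
qed

section \<open>Three pairs with the same quotient\<close>

lemma sum_scale_of_bool:
  assumes "finite W" "x \<in> W"
  shows "(\<Sum>v\<in>W. l2_scale (a * of_bool (v = x)) (f v)) = l2_scale a (f x)"
proof -
  have "(\<Sum>v\<in>W. l2_scale (a * of_bool (v = x)) (f v)) = (\<Sum>v\<in>W. if v = x then l2_scale a (f x) else 0)"
    by (rule sum.cong) auto
  then show ?thesis
    using assms by simp
qed

lemma sum_of_bool_mult:
  assumes "finite W" "x \<in> W"
  shows "(\<Sum>v\<in>W. of_bool (v = x) * of_bool (v = y)) = (of_bool (x = y) :: complex)"
proof -
  have "(\<Sum>v\<in>W. of_bool (v = x) * of_bool (v = y) :: complex) = (\<Sum>v\<in>W. if v = x then of_bool (x = y) else 0)"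
    by (rule sum.cong) auto
  then show ?thesis
    using assms by simp
qed

text \<open>The element of $M_2\otimes\mathcal L(\Gamma)$ used here factors as
  $\binom{\sqrt2\,\lambda_{x}}{\lambda_{y}+\lambda_{z}}\,(1\;\;\lambda_g)$; the vectors \<open>p i\<close> are the images
  of the basis vectors under the projection $\frac12(1\;\;\lambda_g)^*(1\;\;\lambda_g)$.\<close>

lemma (in group) no_triple_if_nonadjacent:
  assumes V: "khintchine_sqrt2 G V" "V \<subseteq> carrier G"
    and g: "g \<in> carrier G" "g \<noteq> \<one>"
    and xyz: "x \<in> V" "y \<in> V" "z \<in> V" "x \<otimes> g \<in> V" "y \<otimes> g \<in> V" "z \<otimes> g \<in> V"
    and ne: "x \<noteq> y" "x \<noteq> z" "y \<noteq> z" "y \<noteq> z \<otimes> g" "z \<noteq> y \<otimes> g"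
  shows False
proof -
  note carr = subsetD[OF V(2) xyz(1)] subsetD[OF V(2) xyz(2)] subsetD[OF V(2) xyz(3)] g(1)
  define W where "W = {x, y, z, x \<otimes> g, y \<otimes> g, z \<otimes> g}"
  \<comment> \<open>The weight sqrt 2 balances the one-term first row against the two-term second
    row: both diagonal entries of \<Sum> C C^* become 4. The off-diagonal entries of \<Sum> C^* C
    count coincidences between {y, z} and {y g, z g}, excluded by \<open>ne\<close> and g \<noteq>
    e; a coincidence such as x = y g does no harm.\<close>
  define C :: "'a \<Rightarrow> complex^2^2" where "C = (\<lambda>v. \<chi> i j.
    if i = 1 then of_real (sqrt 2) * of_bool (v = (if j = 1 then x else x \<otimes> g))
    else if j = 1 then of_bool (v = y) + of_bool (v = z) else of_bool (v = y \<otimes> g) + of_bool (v = z \<otimes> g))"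
  have C: "C v $ 1 $ 1 = of_real (sqrt 2) * of_bool (v = x)" "C v $ 1 $ 2 = of_real (sqrt 2) * of_bool (v = x \<otimes> g)"
    "C v $ 2 $ 1 = of_bool (v = y) + of_bool (v = z)"
    "C v $ 2 $ 2 = of_bool (v = y \<otimes> g) + of_bool (v = z \<otimes> g)" for v
    by (simp_all add: C_def)
  have W: "W \<subseteq> V" "finite W" "W \<noteq> {}" "card W \<le> 6"
    \<comment> \<open>An inequality, not an equality: if x = y g, say, then \<open>W\<close> has
      fewer than six elements. Six is the bound on r in the hypothesis.\<close>
    using xyz card_length[of "[x, y, z, x \<otimes> g, y \<otimes> g, z \<otimes> g]"] by (auto simp: W_def)
  have inW: "x \<in> W" "y \<in> W" "z \<in> W" "x \<otimes> g \<in> W" "y \<otimes> g \<in> W" "z \<otimes> g \<in> W"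
    by (auto simp: W_def)
  have ne': "x \<otimes> g \<noteq> x" "y \<otimes> g \<noteq> y" "z \<otimes> g \<noteq> z" "x \<otimes> g \<noteq> y \<otimes> g" "x \<otimes> g \<noteq> z \<otimes> g" "y \<otimes> g \<noteq> z \<otimes> g"
    using carr g(2) ne(1,2,3) by auto
  note nes = ne ne[symmetric] ne' ne'[symmetric]
  define e :: "'a \<Rightarrow> 'a \<Rightarrow> complex" where "e = (\<lambda>u v. of_bool (v = u))"
  define s where "s = complex_of_real (sqrt 2)"
  have s: "cnj s = s" "s * s = 2"
    by (simp_all add: s_def flip: of_real_mult)
  have e: "cnj (e u v) = e u v" for u v
    by (simp add: e_def)
  have Ce: "C v $ 1 $ 1 = s * e x v" "C v $ 1 $ 2 = s * e (x \<otimes> g) v" "C v $ 2 $ 1 = e y v + e z v"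
    "C v $ 2 $ 2 = e (y \<otimes> g) v + e (z \<otimes> g) v" for v
    by (simp_all add: C e_def s_def)
  have ee: "(\<Sum>v\<in>W. e u v * e w v) = of_bool (u = w)" if "u \<in> W" for u w
    unfolding e_def by (rule sum_of_bool_mult[OF W(2) that])
  have es: "(\<Sum>v\<in>W. (a * e u v) * (b * e w v)) = a * b * of_bool (u = w)"
    "(\<Sum>v\<in>W. (a * e u v) * e w v) = a * of_bool (u = w)"
    "(\<Sum>v\<in>W. e u v * (b * e w v)) = b * of_bool (u = w)" if "u \<in> W" for a b u w
  proof -
    have "(\<Sum>v\<in>W. (a * e u v) * (b * e w v)) = a * b * (\<Sum>v\<in>W. e u v * e w v)" for a b
      by (simp add: sum_distrib_left mult_ac)
    from this[of a b] this[of a 1] this[of 1 b] show "(\<Sum>v\<in>W. (a * e u v) * (b * e w v)) = a * b * of_bool (u = w)"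
      "(\<Sum>v\<in>W. (a * e u v) * e w v) = a * of_bool (u = w)"
      "(\<Sum>v\<in>W. e u v * (b * e w v)) = b * of_bool (u = w)"
      using ee[OF that] by simp_all
  qed
  note entries = vec_eq_iff forall_2 sum_component matrix_matrix_mult_def mat_adj_def mat_def sum_2 Ce
    vec_lambda_beta complex_cnj_add complex_cnj_mult e s(1) distrib_left distrib_right sum.distrib
    inW ee es s(2) nes
  have CC: "(\<Sum>v\<in>W. mat_adj (C v) ** C v) = mat (complex_of_real (2\<^sup>2))"
    by (simp only: entries) simp
  have CC': "(\<Sum>v\<in>W. C v ** mat_adj (C v)) = mat (complex_of_real (2\<^sup>2))"
    by (simp only: entries) simp
  define F where "F = conv_op G W (\<lambda>v. v) C"
  have WG: "v \<in> carrier G" if "v \<in> W" for v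
    using that W(1) V(2) by auto
  have F: "l2_operator (UNIV \<times> carrier G) F"
    unfolding F_def by (rule conv_op_operator[OF WG])
  note lin = bounded_linear.linear[OF l2_operatorD(1)[OF F]]
  \<comment> \<open>\<open>A t\<close> is the column factor applied to \<delta>_t. The two columns
    of f are \<open>A\<close> and \<open>A\<close> after \<lambda>_g, so averaging them, as
    \<open>p\<close> does, leaves \<open>F\<close> unchanged.\<close>
  define A where "A = (\<lambda>t. sqrt 2 *\<^sub>R l2_delta (1, x \<otimes> t) + l2_delta (2, y \<otimes> t) + (l2_delta (2, z \<otimes> t) :: (2 \<times> 'a) l2))"
  have F1: "F (l2_delta (1, t)) = A t" and F2: "F (l2_delta (2, t)) = A (g \<otimes> t)" if t: "t \<in> carrier G" for t
  proof -
    have one: "(\<Sum>v\<in>W. l2_scale (of_bool (v = u)) (f v)) = f u" if "u \<in> W" for u and f :: "_ \<Rightarrow> (2 \<times> 'a) l2"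
      using sum_scale_of_bool[OF W(2) that, of 1 f] by simp
    show "F (l2_delta (1, t)) = A t" "F (l2_delta (2, t)) = A (g \<otimes> t)"
      using inW carr t
      by (simp_all add: F_def conv_op_delta[OF WG t] sum_2 C sum.distrib sum_scale_of_bool[OF W(2)] one
          A_def l2_scale_of_real m_assoc)
  qed
  define p :: "2 \<Rightarrow> (2 \<times> 'a) l2" where
    "p = (\<lambda>i. (1/2) *\<^sub>R (if i = 1 then l2_delta (1, \<one>) + l2_delta (2, inv g) else l2_delta (1, g) + l2_delta (2, \<one>)))"
  have p1: "p 1 = (1/2) *\<^sub>R (l2_delta (1, \<one>) + l2_delta (2, inv g))"
    and p2: "p 2 = (1/2) *\<^sub>R (l2_delta (1, g) + l2_delta (2, \<one>))"
    by (simp_all add: p_def)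
  have half: "(1/2) *\<^sub>R (v + v) = v" for v :: "(2 \<times> 'a) l2"
    by (simp add: scaleR_2[symmetric])
  have Fp: "F (p i) = F (l2_delta (i, \<one>))" for i
  proof -
    have "F (p 1) = F (l2_delta (1, \<one>))" "F (p 2) = F (l2_delta (2, \<one>))"
      using carr by (simp_all only: p1 p2 linear_cmul[OF lin] linear_add[OF lin] F1 F2 one_closed inv_closed
          r_inv r_one half)
    then show ?thesis
      using exhaust_2[of i] by auto
  qed
  note nrm = power2_norm_eq_inner inner_add_left inner_add_right inner_l2_delta_delta
  have "(norm (A t))\<^sup>2 = 4" if "t \<in> carrier G" for t
    using that carr ne by (simp add: A_def nrm)
  then have nF: "(\<Sum>i\<in>UNIV. (norm (F (l2_delta (i, \<one>))))\<^sup>2) = 8"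
    using carr by (simp add: sum_2 F1 F2)
  have np: "(\<Sum>i\<in>UNIV. (norm (p i))\<^sup>2) = 1"
    unfolding sum_2 p1 p2 power2_norm_eq_inner by (simp add: nrm)
  \<comment> \<open>Equality would require F^*F \<delta>_(1,e) = 8 p_1, and p_1 vanishes at (1, t)
    because t \<noteq> e. But y t = z makes the second components of \<open>A t\<close> and
    \<open>A \<one>\<close> overlap, which contributes 1.\<close>
  define t where "t = inv y \<otimes> z"
  have t: "t \<in> carrier G" "y \<otimes> t = z" "t \<noteq> \<one>"
    using carr ne by (auto simp: t_def m_assoc[symmetric]) (metis inv_equality inv_inv inv_closed inv_comm)
  have "inner (F (l2_delta (1, t))) (F (l2_delta (1, \<one>))) \<ge> 1"
    using carr t by (simp add: F1 A_def nrm)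
  moreover have "inner (l2_delta (1, t)) (p 1) = 0"
    using t by (simp add: p1 nrm)
  ultimately have "inner (F (l2_delta (1, t))) (F (l2_delta (1, \<one>))) \<noteq> (sqrt 8)\<^sup>2 * inner (l2_delta (1, t)) (p 1)"
    by simp
  \<comment> \<open>The parameter sqrt 8 is the ratio ||f||_2 / ||p||_2, optimal in the quadratic
    bound. Both sides are 16 sqrt 2, so only the strict form gives a contradiction.\<close>
  then have "4 * 2 * sqrt 8 < sqrt 2 * ((\<Sum>i\<in>UNIV. (norm (F (l2_delta (i, \<one>))))\<^sup>2) +
      (sqrt 8)\<^sup>2 * (\<Sum>i\<in>UNIV. (norm (p i))\<^sup>2))"
    using khintchine_sqrt2_less[where p = p and t = "sqrt 8" and i = 1 and w = "l2_delta (1, t)",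
        OF V W CC CC' _ Fp[unfolded F_def]] unfolding F_def by simp
  then have "4 * 2 * sqrt 8 < sqrt 2 * (16::real)"
    unfolding nF np by simp
  moreover have "sqrt 8 = 2 * sqrt (2::real)"
    using real_sqrt_mult[of 4 2] by simp
  ultimately show False
    by simp
qed

text \<open>On a coset of a subgroup of order 3, the scalar element $1+\lambda_g+\lambda_{g^2}$ is three times a projection.\<close>

lemma (in group) no_coset_of_order_3:
  assumes V: "khintchine_sqrt2 G V" "V \<subseteq> carrier G"
    and g: "g \<in> carrier G" "g \<noteq> \<one>"
    and x: "x \<in> V" "x \<otimes> g \<in> V" "x \<otimes> g \<otimes> g \<in> V" "x \<otimes> g \<otimes> g \<otimes> g = x"
    and ne: "x \<otimes> g \<otimes> g \<noteq> x"
  shows False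
proof -
  note carr = subsetD[OF V(2) x(1)] g(1)
  define W where "W = {x, x \<otimes> g, x \<otimes> g \<otimes> g}"
  \<comment> \<open>The identity matrix doubles the scalar element; three points give c^2 =
    3.\<close>
  define C :: "'a \<Rightarrow> complex^2^2" where "C = (\<lambda>v. mat 1)"
  have ne': "x \<otimes> g \<noteq> x" "x \<otimes> g \<otimes> g \<noteq> x \<otimes> g"
    using carr g(2) by auto
  have card: "card W = 3"
    using ne ne' by (simp add: W_def eq_commute)
  have W: "W \<subseteq> V" "finite W" "W \<noteq> {}" "card W \<le> 6"
    using x card by (auto simp: W_def)
  have adj: "mat_adj (mat 1 :: complex^2^2) = mat 1"
    by (simp add: mat_adj_def mat_def vec_eq_iff)
  have CC: "(\<Sum>v\<in>W. mat_adj (C v) ** C v) = mat (complex_of_real ((sqrt 3)\<^sup>2))"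
    "(\<Sum>v\<in>W. C v ** mat_adj (C v)) = mat (complex_of_real ((sqrt 3)\<^sup>2))"
    by (simp_all add: C_def adj card) (simp_all add: mat_def vec_eq_iff)
  define F where "F = conv_op G W (\<lambda>v. v) C"
  have WG: "v \<in> carrier G" if "v \<in> W" for v
    using that W(1) V(2) by auto
  have "l2_operator (UNIV \<times> carrier G) F"
    unfolding F_def by (rule conv_op_operator[OF WG])
  note lin = bounded_linear.linear[OF l2_operatorD(1)[OF this]]
  define A where "A = (\<lambda>i t. l2_delta (i, x \<otimes> t) + l2_delta (i, x \<otimes> (g \<otimes> t)) + (l2_delta (i, x \<otimes> (g \<otimes> (g \<otimes> t))) :: (2 \<times> 'a) l2))"
  have F: "F (l2_delta (i, t)) = A i t" if t: "t \<in> carrier G" for i t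
  proof -
    have "(\<Sum>j\<in>UNIV. l2_scale (mat 1 $ j $ i) (l2_delta (j, v \<otimes> t))) = l2_delta (i, v \<otimes> t)" for v
      by (cases "i = 1") (use exhaust_2[of i] in \<open>auto simp: sum_2 mat_def\<close>)
    then have "F (l2_delta (i, t)) = (\<Sum>v\<in>W. l2_delta (i, v \<otimes> t))"
      by (simp add: F_def conv_op_delta[OF WG t] C_def)
    then show ?thesis
      using ne ne' carr t by (simp add: W_def A_def m_assoc eq_commute add_ac)
  qed
  have ggg: "x \<otimes> (g \<otimes> (g \<otimes> g)) = x"
    using x(4) carr by (simp add: m_assoc)
  \<comment> \<open>Averages over the subgroup {e, g, g^2}, that is, basis vectors under the
    projection onto its fixed vectors, through which f factors.\<close>
  define p :: "2 \<Rightarrow> (2 \<times> 'a) l2" where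
    "p = (\<lambda>i. (1/3) *\<^sub>R (l2_delta (i, \<one>) + l2_delta (i, g) + l2_delta (i, g \<otimes> g)))"
  have third: "(1/3) *\<^sub>R (v + v + v) = v" for v :: "(2 \<times> 'a) l2"
  proof -
    have "v + v + v = 3 *\<^sub>R v"
      using scaleR_add_left[of 2 1 v] by (simp add: scaleR_2)
    then show ?thesis
      by simp
  qed
  have g3: "g \<otimes> (g \<otimes> g) = \<one>"
    using ggg carr by simp
  have g4: "g \<otimes> (g \<otimes> (g \<otimes> g)) = g"
    by (simp add: g3 carr)
  have A: "A i g = A i \<one>" "A i (g \<otimes> g) = A i \<one>" for i
    using carr by (simp_all add: A_def g3 g4 add_ac)
  have Fp: "F (p i) = F (l2_delta (i, \<one>))" for i
    using carr by (simp add: p_def linear_cmul[OF lin] linear_add[OF lin] F A third)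
  note nrm = power2_norm_eq_inner inner_add_left inner_add_right inner_l2_delta_delta
  have gg: "g \<otimes> g \<noteq> \<one>" "g \<otimes> g \<noteq> g"
    using ne ne' carr g(2) by (auto simp: m_assoc)
  have "(norm (F (l2_delta (i, \<one>))))\<^sup>2 = 3" for i
    using carr g(2) gg by (simp add: F A_def nrm g(2)[symmetric] gg[symmetric])
  moreover have "(norm (p i))\<^sup>2 = 1 / 3" for i
    unfolding p_def power2_norm_eq_inner using g(2) gg by (simp add: nrm g(2)[symmetric] gg[symmetric])
  \<comment> \<open>Again t is the ratio of the 2-norms: ||f||_2^2 = 6 and ||p||_2^2 = 2/3, so t =
    3. The bound reads 12 sqrt 3 \<le> 12 sqrt 2.\<close>
  moreover have "4 * sqrt 3 * 3 \<le> sqrt 2 * ((\<Sum>i\<in>UNIV. (norm (F (l2_delta (i, \<one>))))\<^sup>2) +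
      3\<^sup>2 * (\<Sum>i\<in>UNIV. (norm (p i))\<^sup>2))"
    using khintchine_sqrt2_le[where p = p and t = 3, OF V W CC _ Fp[unfolded F_def]] unfolding F_def by simp
  ultimately have "4 * sqrt 3 * 3 \<le> sqrt 2 * (3 + 3 + 3\<^sup>2 * (1 / 3 + 1 / 3))"
    by (simp only: sum_2)
  then have "sqrt 3 \<le> sqrt (2::real)"
    by simp
  then show False
    by simp
qed

text \<open>Join u to v when v = u g. Among three first components every two are joined, since
  \<open>no_triple_if_nonadjacent\<close> applies with each of them in the role of \<open>x\<close>.
  No point has two successors or two predecessors, so the three form a directed triangle, which is a
  coset of a group of order 3.\<close>

lemma (in group) Z2c_le_2:
  assumes V: "khintchine_sqrt2 G V" "V \<subseteq> carrier G"
  shows "Z2c G V \<le> 2"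
  unfolding Z2c_def
proof (rule SUP_least)
  fix g assume "g \<in> carrier G - {\<one>}"
  then have g: "g \<in> carrier G" "g \<noteq> \<one>"
    by auto
  define S where "S = {(x, y) \<in> V \<times> V. inv x \<otimes> y = g}"
  have S: "snd s = fst s \<otimes> g \<and> fst s \<in> V \<and> fst s \<otimes> g \<in> V" if s_in: "s \<in> S" for s
  proof -
    obtain x y where s: "s = (x, y)" "x \<in> V" "y \<in> V" "inv x \<otimes> y = g"
      using s_in by (auto simp: S_def)
    then have "y = x \<otimes> g"
      using subsetD[OF V(2) s(2)] subsetD[OF V(2) s(3)] s(4) inv_solve_left'[of g x y] g by simp
    with s show ?thesis
      by simp
  qed
  have no_T: False if T: "T \<subseteq> S" "card T = 3" for T
  proof -
    obtain s1 s2 s3 where s: "T = {s1, s2, s3}" "s1 \<noteq> s2" "s1 \<noteq> s3" "s2 \<noteq> s3"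
      using T(2) by (auto simp: card_3_iff)
    define x y z where "x = fst s1" "y = fst s2" "z = fst s3"
    have xyz: "x \<in> V" "y \<in> V" "z \<in> V" "x \<otimes> g \<in> V" "y \<otimes> g \<in> V" "z \<otimes> g \<in> V"
      and ne: "x \<noteq> y" "x \<noteq> z" "y \<noteq> z"
      using S T(1) s by (auto simp: x_y_z_def prod_eq_iff)
    note tri = no_triple_if_nonadjacent[OF V g]
    have adj: "y = z \<otimes> g \<or> z = y \<otimes> g" "x = z \<otimes> g \<or> z = x \<otimes> g" "x = y \<otimes> g \<or> y = x \<otimes> g"
      using tri[of x y z] tri[of y x z] tri[of z x y] xyz ne by metis+
    have cyc: False if "b = a \<otimes> g" "c = b \<otimes> g" "a = c \<otimes> g" "a \<in> V" "b \<in> V" "c \<in> V" "a \<noteq> c" for a b c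
      using no_coset_of_order_3[OF V g, of a, folded that(1), folded that(2), folded that(3)] that(4-7)
      by blast
    show False
      \<comment> \<open>The two orientations of the triangle.\<close>
      using adj ne cyc[of x y z] cyc[of y x z] xyz by metis
  qed
  \<comment> \<open>Excludes the value \<infinity> of \<open>ecard\<close>: an infinite set would
    also contain three pairs.\<close>
  have "finite S"
    using infinite_arbitrarily_large[of S 3] no_T by blast
  moreover have "card S < 3"
  proof (rule ccontr)
    assume "\<not> card S < 3"
    then obtain T where "T \<subseteq> S" "card T = 3"
      using obtain_subset_with_card_n[of 3 S] by (auto simp: not_less)
    then show False
      by (rule no_T)
  qed
  ultimately show "ecard {(x, y) \<in> V \<times> V. inv x \<otimes> y = g} \<le> 2"
    unfolding S_def[symmetric] by (simp add: ecard_def numeral_eq_enat)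
qed

theorem theorem2p3:
  fixes G :: "('a, 'b) monoid_scheme" and V :: "'a set"
  assumes "group G" and "V \<subseteq> carrier G"
    and "\<And>(r::nat) (g :: nat \<Rightarrow> 'a) (C :: nat \<Rightarrow> complex^2^2).
           \<lbrakk>1 \<le> r; r \<le> 6; \<forall>m\<in>{1..r}. g m \<in> V; inj_on g {1..r}\<rbrakk> \<Longrightarrow>
           S1_ell2_norm {1..r} C \<le>
             sqrt 2 * Re (tr_vn_trace G (op_abs (UNIV \<times> carrier G)
               (op_sum (UNIV \<times> carrier G) {1..r}
                  (\<lambda>m. mat_tensor (carrier G) (C m) (left_reg G (g m))))))"
  shows "Z2 G V \<le> 2"
proof -
  interpret group G by fact
  have V: "khintchine_sqrt2 G V"
    unfolding khintchine_sqrt2_def using assms(3) by blast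
  have "(\<lambda>x. inv\<^bsub>G\<^esub> x) ` V \<subseteq> carrier G"
    using assms(2) by auto
  then show ?thesis
    using Z2c_le_2[OF V assms(2)] Z2c_le_2[OF khintchine_sqrt2_inv[OF V assms(2)]]
    by (simp add: Z2_def Z2r_def)
qed

end
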